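(* Let $\Omega=((\Psi_n,M_n,P_n))_{n\in\mathbb{N}}$ be an admissible module-sequence on $L^2(\mathbb{R}^d)$ with output-generating atoms $\chi_n$, $n\in\mathbb{N}_0$, let $S_n\ge 1$, $n\in\mathbb{N}$, be the pooling factors, and let $\Phi_\Omega^n(f)=\{(U[q]f)\ast\chi_n\}_{q\in\Lambda_1^n}$ denote the features of $f\in L^2(\mathbb{R}^d)$ generated in the $n$-th network layer. Assume that the operators $M_n:L^2(\mathbb{R}^d)\to L^2(\mathbb{R}^d)$ and $P_n:L^2(\mathbb{R}^d)\to L^2(\mathbb{R}^d)$ commute with translations, i.e., $$M_nT_tf=T_tM_nf,\qquad P_nT_tf=T_tP_nf,$$ for all $f\in L^2(\mathbb{R}^d)$, $t\in\mathbb{R}^d$, and $n\in\mathbb{N}$. (i) For all $f\in L^2(\mathbb{R}^d)$, $t\in\mathbb{R}^d$, and $n\in\mathbb{N}$, $$\Phi_\Omega^n(T_tf)=T_{t/(S_1\cdots S_n)}\Phi_\Omega^n(f),$$ where $T_s\Phi_\Omega^n(f)$ refers to element-wise application of $T_s$, i.e., $T_s\Phi_\Omega^n(f)=\{T_s((U[q]f)\ast\chi_n)\}_{q\in\Lambda_1^n}$. (ii) If, in addition, there exists a constant $K>0$ (that does not depend on $n$) such that the Fourier transforms of the output-generating atoms satisfy $$|\widehat{\chi_n}(\omega)|\,|\omega|\le K,\qquad \text{for a.e. }\omega\in\mathbb{R}^d,\ \text{for all } n\in\mathbb{N}_0,$$ then $$|||\Phi_\Omega^n(T_tf)-\Phi_\Omega^n(f)|||\le\frac{2\pi|t|K}{S_1\cdots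 S_n}\|f\|_2,$$ for all $f\in L^2(\mathbb{R}^d)$, $t\in\mathbb{R}^d$, and $n\in\mathbb{N}$.
   Context: Notation: $\mathbb{N}=\{1,2,\dots\}$, $\mathbb{N}_0=\mathbb{N}\cup\{0\}$; $L^2(\mathbb{R}^d)$ consists of complex-valued functions. $(T_tf)(x):=f(x-t)$; $(If)(x):=\overline{f(-x)}$; $\widehat f(\omega):=\int_{\mathbb{R}^d}f(x)e^{-2\pi i\langle x,\omega\rangle}dx$ for $f\in L^1(\mathbb{R}^d)$, extended as usual to $L^2(\mathbb{R}^d)$; $(f\ast g)(y):=\int_{\mathbb{R}^d}f(x)g(y-x)dx$; $|\cdot|$ is the Euclidean norm on $\mathbb{R}^d$. Semi-discrete frame: for a countable index set $\Lambda$ and atoms $\{g_\lambda\}_{\lambda\in\Lambda}\subseteq L^1(\mathbb{R}^d)\cap L^2(\mathbb{R}^d)$, the collection $\{T_bIg_\lambda\}_{(\lambda,b)\in\Lambda\times\mathbb{R}^d}$ is a semi-discrete frame for $L^2(\mathbb{R}^d)$ with frame bounds $A,B>0$ if $A\|f\|_2^2\le\sum_{\lambda\in\Lambda}\int_{\mathbb{R}^d}|\langle f,T_bIg_\lambda\rangle|^2db=\sum_{\lambda\in\Lambda}\|f\ast g_\lambda\|_2^2\le B\|f\|_2^2$ for all $f\in L^2(\mathbb{R}^d)$. Module-sequence: $\Omega=((\Psi_n,M_n,P_n))_{n\in\mathbb{N}}$ where, for each $n$, $\Psi_n=\{T_bIg_{\lambda_n}\}_{b\in\mathbb{R}^d,\,\lambda_n\in\widetilde\Lambda_n}$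 is a semi-discrete frame for $L^2(\mathbb{R}^d)$ with countable index set $\widetilde\Lambda_n$ and upper frame bound $B_n>0$, and $M_n,P_n:L^2(\mathbb{R}^d)\to L^2(\mathbb{R}^d)$ are (possibly non-linear) Lipschitz-continuous operators with Lipschitz constants $L_n>0$ and $R_n>0$ respectively (i.e., $\|M_nf-M_nh\|_2\le L_n\|f-h\|_2$ and $\|P_nf-P_nh\|_2\le R_n\|f-h\|_2$ for all $f,h$) and with $M_n0=0$, $P_n0=0$. To each layer $n\in\mathbb{N}$ is associated a pooling factor $S_n\ge1$. In each frame $\Psi_n$ one atom, with index $\lambda_n^\ast\in\widetilde\Lambda_n$, is designated as output-generating atom of layer $n-1$: $\chi_{n-1}:=g_{\lambda_n^\ast}$, $n\in\mathbb{N}$. Set $\Lambda_n:=\widetilde\Lambda_n\setminus\{\lambda_n^\ast\}$. $\Omega$ is called admissible if $\max\{B_n,B_nL_n^2R_n^2\}\le1$ for all $n\in\mathbb{N}$. Network: for $\lambda_n\in\Lambda_n$ and $f\in L^2(\mathbb{R}^d)$, $U_n[\lambda_n]f:=S_n^{d/2}\,P_n\big(M_n(f\ast g_{\lambda_n})\big)(S_n\,\cdot)$. Paths: $\Lambda_1^n:=\Lambda_1\times\cdots\times\Lambda_n$ for $n\in\mathbb{N}$, $\Lambda_1^0:=\{e\}$ with $e$ the empty path. For $q=(\lambda_1,\dots,\lambda_n)\in\Lambda_1^n$, $U[q]f:=U_n[\lambda_n]\cdots U_2[\lambda_2]U_1[\lambda_1]f$, and $U[e]f:=f$. For a family $s=\{s_q\}_q$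 of functions in $L^2(\mathbb{R}^d)$ indexed by a countable set, $|||s|||:=(\sum_q\|s_q\|_2^2)^{1/2}$; differences of families are taken index-wise. *)

theory Defs
  imports "HOL-Analysis.Analysis"
begin

text \<open>
  The space of dimension d is a Euclidean space \<open>'a\<close> with d = \<open>DIM('a)\<close>.  Elements of L1 and L2 are
  represented by Borel functions; equality of elements is equality almost everywhere, and an operator on
  L2 is a map on representatives.  A Lipschitz operator respects equality almost everywhere, so it
  induces a map on equivalence classes.
\<close>

definition L1 :: "('a::euclidean_space \<Rightarrow> complex) set" where
  "L1 = {f. integrable lborel f}"

definition L2 :: "('a::euclidean_space \<Rightarrow> complex) set" where
  "L2 = {f \<in> borel_measurable lborel. integrable lborel (\<lambda>x. (cmod (f x))\<^sup>2)}"

text \<open>The norm is only meaningful on \<open>L2\<close>: outside it the Bochner integral defaults to 0.\<close>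

definition L2_norm :: "('a::euclidean_space \<Rightarrow> complex) \<Rightarrow> real" where
  "L2_norm f = sqrt (LINT x|lborel. (cmod (f x))\<^sup>2)"

definition L2_inner :: "('a::euclidean_space \<Rightarrow> complex) \<Rightarrow> ('a \<Rightarrow> complex) \<Rightarrow> complex" where
  "L2_inner f h = (LINT x|lborel. f x * cnj (h x))"

definition translate :: "'a::euclidean_space \<Rightarrow> ('a \<Rightarrow> complex) \<Rightarrow> ('a \<Rightarrow> complex)" where
  "translate t f = (\<lambda>x. f (x - t))"

definition involution :: "('a::euclidean_space \<Rightarrow> complex) \<Rightarrow> ('a \<Rightarrow> complex)" where
  "involution f = (\<lambda>x. cnj (f (- x)))"

definition conv :: "('a::euclidean_space \<Rightarrow> complex) \<Rightarrow> ('a \<Rightarrow> complex) \<Rightarrow> ('a \<Rightarrow> complex)" where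
  "conv f g = (\<lambda>y. LINT x|lborel. f x * g (y - x))"

text \<open>The Fourier integral on \<open>L1\<close>, which suffices because atoms lie in \<open>L1 \<inter> L2\<close>.\<close>

definition fourier :: "('a::euclidean_space \<Rightarrow> complex) \<Rightarrow> ('a \<Rightarrow> complex)" where
  "fourier f = (\<lambda>w. LINT x|lborel. f x * exp (- 2 * complex_of_real pi * \<i> * complex_of_real (x \<bullet> w)))"

text \<open>The sum and the integral take values in \<open>ennreal\<close>, so that no convergence is presupposed.\<close>

definition semi_discrete_frame ::
  "'i set \<Rightarrow> ('i \<Rightarrow> 'a::euclidean_space \<Rightarrow> complex) \<Rightarrow> real \<Rightarrow> real \<Rightarrow> bool" where
  "semi_discrete_frame I g A B \<longleftrightarrow>
     countable I \<and> (\<forall>l\<in>I. g l \<in> L1 \<inter> L2) \<and> A > 0 \<and> B > 0 \<and>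
     (\<forall>f\<in>L2.
        ennreal (A * (L2_norm f)\<^sup>2)
          \<le> (\<Sum>\<^sub>\<infinity>l\<in>I. \<integral>\<^sup>+b. ennreal ((cmod (L2_inner f (translate b (involution (g l)))))\<^sup>2) \<partial>lborel) \<and>
        (\<Sum>\<^sub>\<infinity>l\<in>I. \<integral>\<^sup>+b. ennreal ((cmod (L2_inner f (translate b (involution (g l)))))\<^sup>2) \<partial>lborel)
          \<le> ennreal (B * (L2_norm f)\<^sup>2))"

lemma L2_inner_translate_involution:
  "L2_inner f (translate b (involution g)) = conv f g b"
  by (simp add: L2_inner_def translate_def involution_def conv_def)

definition L2_lipschitz ::
  "real \<Rightarrow> (('a::euclidean_space \<Rightarrow> complex) \<Rightarrow> ('a \<Rightarrow> complex)) \<Rightarrow> bool" where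
  "L2_lipschitz C F \<longleftrightarrow>
     (\<forall>f\<in>L2. F f \<in> L2) \<and>
     (\<forall>f\<in>L2. \<forall>h\<in>L2. L2_norm (\<lambda>x. F f x - F h x) \<le> C * L2_norm (\<lambda>x. f x - h x))"

definition commutes_with_translations ::
  "(('a::euclidean_space \<Rightarrow> complex) \<Rightarrow> ('a \<Rightarrow> complex)) \<Rightarrow> bool" where
  "commutes_with_translations F \<longleftrightarrow>
     (\<forall>f\<in>L2. \<forall>t. AE x in lborel. F (translate t f) x = translate t (F f) x)"

text \<open>
  Layers are numbered from 1; the values of all fields at 0 are irrelevant.  \<open>index \<Omega> n\<close> is the full
  index set of the n-th frame, including the index \<open>out_index \<Omega> n\<close> of its output-generating atom.
\<close>

record ('i, 'a) module_seq =
  index :: "nat \<Rightarrow> 'i set"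
  atom :: "nat \<Rightarrow> 'i \<Rightarrow> 'a \<Rightarrow> complex"
  out_index :: "nat \<Rightarrow> 'i"
  nonlin :: "nat \<Rightarrow> ('a \<Rightarrow> complex) \<Rightarrow> ('a \<Rightarrow> complex)"
  pool :: "nat \<Rightarrow> ('a \<Rightarrow> complex) \<Rightarrow> ('a \<Rightarrow> complex)"
  frame_bd :: "nat \<Rightarrow> real"
  nonlin_lip :: "nat \<Rightarrow> real"
  pool_lip :: "nat \<Rightarrow> real"

definition module_sequence :: "('i, 'a::euclidean_space) module_seq \<Rightarrow> bool" where
  "module_sequence \<Omega> \<longleftrightarrow>
     (\<forall>n\<ge>1.
        (\<exists>A. semi_discrete_frame (index \<Omega> n) (atom \<Omega> n) A (frame_bd \<Omega> n)) \<and>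
        out_index \<Omega> n \<in> index \<Omega> n \<and>
        nonlin_lip \<Omega> n > 0 \<and> L2_lipschitz (nonlin_lip \<Omega> n) (nonlin \<Omega> n) \<and>
        (AE x in lborel. nonlin \<Omega> n (\<lambda>_. 0) x = 0) \<and>
        pool_lip \<Omega> n > 0 \<and> L2_lipschitz (pool_lip \<Omega> n) (pool \<Omega> n) \<and>
        (AE x in lborel. pool \<Omega> n (\<lambda>_. 0) x = 0))"

definition admissible :: "('i, 'a::euclidean_space) module_seq \<Rightarrow> bool" where
  "admissible \<Omega> \<longleftrightarrow>
     (\<forall>n\<ge>1. max (frame_bd \<Omega> n) (frame_bd \<Omega> n * (nonlin_lip \<Omega> n)\<^sup>2 * (pool_lip \<Omega> n)\<^sup>2) \<le> 1)"

text \<open>The output-generating atom of layer n belongs to the frame of layer n + 1.\<close>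

definition out_atom :: "('i, 'a::euclidean_space) module_seq \<Rightarrow> nat \<Rightarrow> 'a \<Rightarrow> complex" where
  "out_atom \<Omega> n = atom \<Omega> (Suc n) (out_index \<Omega> (Suc n))"

definition inner_index :: "('i, 'a::euclidean_space) module_seq \<Rightarrow> nat \<Rightarrow> 'i set" where
  "inner_index \<Omega> n = index \<Omega> n - {out_index \<Omega> n}"

definition layer_op ::
  "('i, 'a::euclidean_space) module_seq \<Rightarrow> (nat \<Rightarrow> real) \<Rightarrow> nat \<Rightarrow> 'i \<Rightarrow> ('a \<Rightarrow> complex) \<Rightarrow> ('a \<Rightarrow> complex)"
where
  "layer_op \<Omega> S n l f =
     (\<lambda>x. complex_of_real (S n powr (real DIM('a) / 2)) *
           pool \<Omega> n (nonlin \<Omega> n (conv f (atom \<Omega> n l))) (S n *\<^sub>R x))"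

text \<open>A path is a list; its k-th entry, counted from 0, is an index of layer k + 1.\<close>

definition paths :: "('i, 'a::euclidean_space) module_seq \<Rightarrow> nat \<Rightarrow> 'i list set" where
  "paths \<Omega> n = {q. length q = n \<and> (\<forall>k<n. q ! k \<in> inner_index \<Omega> (Suc k))}"

definition path_op ::
  "('i, 'a::euclidean_space) module_seq \<Rightarrow> (nat \<Rightarrow> real) \<Rightarrow> 'i list \<Rightarrow> ('a \<Rightarrow> complex) \<Rightarrow> ('a \<Rightarrow> complex)"
where
  "path_op \<Omega> S q f = fold (\<lambda>(k, l). layer_op \<Omega> S k l) (List.enumerate 1 q) f"

definition features ::
  "('i, 'a::euclidean_space) module_seq \<Rightarrow> (nat \<Rightarrow> real) \<Rightarrow> nat \<Rightarrow> ('a \<Rightarrow> complex) \<Rightarrow> 'i list \<Rightarrow> ('a \<Rightarrow> complex)"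
where
  "features \<Omega> S n f q = conv (path_op \<Omega> S q f) (out_atom \<Omega> n)"

text \<open>
  \<open>L2_family_norm\<close> is only meaningful for families satisfying \<open>L2_family\<close>, since a divergent
  \<open>infsum\<close> of reals defaults to 0.
\<close>

definition L2_family :: "'q set \<Rightarrow> ('q \<Rightarrow> 'a::euclidean_space \<Rightarrow> complex) \<Rightarrow> bool" where
  "L2_family Q s \<longleftrightarrow> (\<forall>q\<in>Q. s q \<in> L2) \<and> (\<lambda>q. (L2_norm (s q))\<^sup>2) summable_on Q"

definition L2_family_norm :: "'q set \<Rightarrow> ('q \<Rightarrow> 'a::euclidean_space \<Rightarrow> complex) \<Rightarrow> real" where
  "L2_family_norm Q s = sqrt (\<Sum>\<^sub>\<infinity>q\<in>Q. (L2_norm (s q))\<^sup>2)"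

end

theory Submission
  imports Defs "HOL-Probability.Characteristic_Functions"
begin

text \<open>
  Convolution commutes with translations, and dilating by the pooling factor divides the translation
  parameter by that factor; layer by layer this gives the first claim.  Hence the n-th layer difference at
  a path q is the convolution of \<open>U[q] f\<close> with \<open>T_s \<chi> - \<chi>\<close>, where s is t over the product of the pooling
  factors.  The Fourier transform of \<open>T_s \<chi> - \<chi>\<close> is bounded by \<open>2 \<pi> |s| |\<omega>| |\<chi>^(\<omega>)| \<le> 2 \<pi> |s| K\<close>, and a
  bound on the Fourier transform of the kernel bounds the convolution operator on L2.  Admissibility makes
  every layer a contraction in total energy, so the squared norms of \<open>U[q] f\<close> over the paths q of length n
  sum up to at most the squared norm of f.
\<close>

section \<open>Affine substitutions and Gaussians on a Euclidean space\<close>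

text \<open>Only Fourier integrals of integrable functions occur. The squared modulus of such a
  transform need not be integrable, which is why it is weighted by
  \<open>gauss (r *\<^sub>R w)\<close>: the weighted integral is finite, a pointwise bound on the
  transform of the kernel compares two of them, and as r \<rightarrow> 0 it recovers the squared L2
  norm of a bounded, continuous, integrable function. A convolution of a bounded integrable function
  with an integrable kernel is of this kind, its continuity being that of translation in
  \<open>L1\<close>. Truncation and Fatou's lemma then reach all of \<open>L2\<close>.

  The second obstacle is that the operators act on representatives and commute with translations
  only almost everywhere. Lipschitz operators and dilations respect equality almost everywhere, and
  a convolution turns such an equality of its first factor into equality at every point, so
  exceptional sets never accumulate along a path.\<close>

lemma nn_integral_affine:
  fixes f :: "'a::euclidean_space \<Rightarrow> ennreal"
  assumes [measurable]: "f \<in> borel_measurable borel" and c: "c \<noteq> 0"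
  shows "(\<integral>\<^sup>+x. f x \<partial>lborel) = ennreal (\<bar>c\<bar> ^ DIM('a)) * (\<integral>\<^sup>+x. f (t + c *\<^sub>R x) \<partial>lborel)"
  by (subst lborel_affine[OF c, of t])
    (simp add: nn_integral_density nn_integral_distr nn_integral_cmult)

lemma integrable_affine:
  fixes f :: "'a::euclidean_space \<Rightarrow> 'b::{banach, second_countable_topology}"
  assumes f: "integrable lborel f" and c: "c \<noteq> 0"
  shows "integrable lborel (\<lambda>x. f (t + c *\<^sub>R x))"
proof -
  have [measurable]: "f \<in> borel_measurable borel"
    using f by auto
  have "(\<integral>\<^sup>+x. norm (f x) \<partial>lborel) < \<infinity>"
    using f by (simp add: integrable_iff_bounded)
  then have "(\<integral>\<^sup>+x. norm (f (t + c *\<^sub>R x)) \<partial>lborel) < \<infinity>"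
    using c by (subst (asm) nn_integral_affine[where c=c and t=t]) (auto simp: ennreal_mult_less_top)
  then show ?thesis
    by (simp add: integrable_iff_bounded)
qed

lemma integrable_affine_iff:
  fixes f :: "'a::euclidean_space \<Rightarrow> 'b::{banach, second_countable_topology}"
  assumes "c \<noteq> 0"
  shows "integrable lborel (\<lambda>x. f (t + c *\<^sub>R x)) \<longleftrightarrow> integrable lborel f"
  using integrable_affine[of f c t] assms
    integrable_affine[of "\<lambda>x. f (t + c *\<^sub>R x)" "1/c" "-((1/c) *\<^sub>R t)"]
  by (auto simp: scaleR_add_right scaleR_diff_right)

lemma integral_affine:
  fixes f :: "'a::euclidean_space \<Rightarrow> 'b::{banach, second_countable_topology}"
  assumes c: "c \<noteq> 0"
  shows "(LINT x|lborel. f (t + c *\<^sub>R x)) = (1 / \<bar>c\<bar> ^ DIM('a)) *\<^sub>R (LINT x|lborel. f x)"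
proof (cases "integrable lborel f")
  case True
  then have [measurable]: "f \<in> borel_measurable borel"
    by auto
  have "(LINT x|lborel. f x) = \<bar>c\<bar> ^ DIM('a) *\<^sub>R (LINT x|lborel. f (t + c *\<^sub>R x))"
    using integrable_affine[OF True c, of t] c
    by (subst lborel_affine[OF c, of t]) (simp add: integral_density integral_distr)
  then show ?thesis
    using c by simp
next
  case False
  then show ?thesis
    using integrable_affine_iff[OF c, of f t] by (simp add: not_integrable_integral_eq)
qed

text \<open>The change of variables formula, applied to the indicator of a null set, shows that its
  preimage is null. The dilation in \<open>layer_op\<close> relies on this.\<close>

lemma AE_affine:
  fixes t :: "'a::euclidean_space"
  assumes P: "AE x in lborel. P x" and c: "c \<noteq> 0"
  shows "AE x in lborel. P (t + c *\<^sub>R x)"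
proof -
  obtain N where N: "N \<in> null_sets lborel" "{x. \<not> P x} \<subseteq> N"
    using P by (auto simp: eventually_ae_filter)
  then have [measurable]: "N \<in> sets borel"
    by auto
  have "ennreal (\<bar>c\<bar> ^ DIM('a)) * (\<integral>\<^sup>+x. indicator N (t + c *\<^sub>R x) \<partial>lborel) = 0"
    using nn_integral_affine[OF _ c, of "indicator N" t] N(1) by (auto simp: null_sets_def)
  then have "(\<integral>\<^sup>+x. indicator N (t + c *\<^sub>R x) \<partial>lborel) = 0"
    using c by simp
  then have "AE x in lborel. (indicator N (t + c *\<^sub>R x) :: ennreal) = 0"
    by (subst (asm) nn_integral_0_iff_AE) auto
  then show ?thesis
    using N(2) by (auto simp: indicator_def split: if_splits)
qed

lemma
  fixes f :: "'a::euclidean_space \<Rightarrow> 'b::{banach, second_countable_topology}"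
  shows integrable_lborel_translate: "integrable lborel (\<lambda>x. f (x - t)) \<longleftrightarrow> integrable lborel f"
    and integral_lborel_translate: "(LINT x|lborel. f (x - t)) = (LINT x|lborel. f x)"
    and integrable_lborel_reflect: "integrable lborel (\<lambda>x. f (t - x)) \<longleftrightarrow> integrable lborel f"
    and integral_lborel_reflect: "(LINT x|lborel. f (t - x)) = (LINT x|lborel. f x)"
  using integrable_affine_iff[of 1 f "-t"] integral_affine[of 1 f "-t"]
    integrable_affine_iff[of "-1" f t] integral_affine[of "-1" f t]
  by simp_all

lemma nn_integral_lborel_translate:
  fixes f :: "'a::euclidean_space \<Rightarrow> ennreal"
  assumes "f \<in> borel_measurable borel"
  shows "(\<integral>\<^sup>+x. f (x - t) \<partial>lborel) = (\<integral>\<^sup>+x. f x \<partial>lborel)"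
  using nn_integral_affine[OF assms, of 1 "-t"] by simp

text \<open>\<open>lborel\<close> is the image of the product measure over \<open>Basis\<close>
  under the coordinate map, so Fubini for finite products applies. This reduces Gaussian integrals
  to one dimension.\<close>

lemma
  fixes f :: "'a::euclidean_space \<Rightarrow> real \<Rightarrow> complex"
  assumes f: "\<And>b. b \<in> Basis \<Longrightarrow> integrable lborel (f b)"
  shows integrable_lborel_prod: "integrable lborel (\<lambda>x. \<Prod>b\<in>Basis. f b (x \<bullet> b))"
    and integral_lborel_prod:
      "(LINT x|lborel. (\<Prod>b\<in>Basis. f b (x \<bullet> b))) = (\<Prod>b\<in>Basis. (LINT x|lborel. f b x))"
proof -
  interpret product_sigma_finite "\<lambda>_::'a. lborel :: real measure" ..
  have [measurable]: "b \<in> Basis \<Longrightarrow> f b \<in> borel_measurable borel" for b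
    using f by auto
  have *: "(\<Prod>b\<in>Basis. f b ((\<Sum>b'\<in>Basis. g b' *\<^sub>R b') \<bullet> b)) = (\<Prod>b\<in>Basis. f b (g b))" for g
    by (intro prod.cong) auto
  show "integrable lborel (\<lambda>x. \<Prod>b\<in>Basis. f b (x \<bullet> b))"
    by (subst lborel_eq, subst integrable_distr_eq)
      (auto simp: * intro!: product_integrable_prod f)
  show "(LINT x|lborel. (\<Prod>b\<in>Basis. f b (x \<bullet> b))) = (\<Prod>b\<in>Basis. (LINT x|lborel. f b x))"
    by (subst lborel_eq, subst integral_distr)
      (auto simp: * intro!: product_integral_prod f)
qed

lemma fourier_cexp:
  "fourier f w = (LINT x|lborel. f x * exp (\<i> * complex_of_real (- 2 * pi * (x \<bullet> w))))"
  unfolding fourier_def by (intro Bochner_Integration.integral_cong) (auto simp: algebra_simps)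

section \<open>Gaussians and their Fourier transforms\<close>

definition gauss :: "'a::euclidean_space \<Rightarrow> real" where
  "gauss w = exp (- (norm w)\<^sup>2 / 2)"

text \<open>In closed form (2\<pi>)^(d/2) exp(-2\<pi>^2 |z|^2). The product form shows that it is a
  probability density, and its rescalings form an approximate identity.\<close>

definition fourier_gauss :: "'a::euclidean_space \<Rightarrow> real" where
  "fourier_gauss z = (\<Prod>b\<in>Basis. normal_density 0 (1 / (2 * pi)) (z \<bullet> b))"

lemma gauss_prod: "gauss w = (\<Prod>b\<in>Basis. exp (- (w \<bullet> b)\<^sup>2 / 2))"
proof -
  have "(norm w)\<^sup>2 = (\<Sum>b\<in>Basis. (w \<bullet> b)\<^sup>2)"
    unfolding power2_norm_eq_inner by (subst euclidean_inner) (simp add: power2_eq_square)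
  then have "- (norm w)\<^sup>2 / 2 = (\<Sum>b\<in>Basis. - (w \<bullet> b)\<^sup>2 / 2)"
    by (simp add: sum_negf sum_divide_distrib)
  then show ?thesis
    by (simp add: gauss_def exp_sum)
qed

text \<open>Up to the factor sqrt(2\<pi>) the integrand is the standard normal density times
  exp(itx) with t = -2\<pi>z, so the integral is a value of the characteristic function
  exp(-t^2/2).\<close>

lemma fourier_gauss_1D:
  "integrable lborel (\<lambda>x. complex_of_real (exp (- x\<^sup>2 / 2)) * exp (\<i> * complex_of_real (- 2 * pi * (x * z))))"
  "(LINT x|lborel. complex_of_real (exp (- x\<^sup>2 / 2)) * exp (\<i> * complex_of_real (- 2 * pi * (x * z))))
    = normal_density 0 (1 / (2 * pi)) z"
proof -
  define t where "t = - 2 * pi * z"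
  have e: "complex_of_real (exp (- x\<^sup>2 / 2)) * exp (\<i> * complex_of_real (- 2 * pi * (x * z)))
    = complex_of_real (sqrt (2 * pi)) * (std_normal_density x *\<^sub>R iexp (t * x))" for x
    by (simp add: std_normal_density_def t_def scaleR_conv_of_real mult_ac)
  have i: "integrable lborel (\<lambda>x. std_normal_density x *\<^sub>R iexp (t * x))"
    by (rule Bochner_Integration.integrable_bound[OF integrable_normal_density[of 1 0]]) auto
  show "integrable lborel (\<lambda>x. complex_of_real (exp (- x\<^sup>2 / 2)) * exp (\<i> * complex_of_real (- 2 * pi * (x * z))))"
    unfolding e by (rule integrable_mult_right) (rule i)
  have "(LINT x|lborel. std_normal_density x *\<^sub>R iexp (t * x)) = char std_normal_distribution t"
    unfolding char_def by (subst integral_density) auto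
  also have "\<dots> = exp (- (t^2) / 2)"
    by (simp add: char_std_normal_distribution)
  finally have s: "(LINT x|lborel. std_normal_density x *\<^sub>R iexp (t * x)) = exp (- (t^2) / 2)" .
  have n: "sqrt (2 * pi) * exp (- (t^2) / 2) = normal_density 0 (1 / (2 * pi)) z"
  proof -
    have "sqrt (2 * pi * (1 / (2 * pi))\<^sup>2) = 1 / sqrt (2 * pi)"
      by (simp add: power2_eq_square real_sqrt_divide)
    then show ?thesis
      by (simp add: normal_density_def t_def power2_eq_square field_simps)
  qed
  show "(LINT x|lborel. complex_of_real (exp (- x\<^sup>2 / 2)) * exp (\<i> * complex_of_real (- 2 * pi * (x * z))))
    = normal_density 0 (1 / (2 * pi)) z"
    unfolding e by (simp only: integral_mult_right_zero s n flip: of_real_mult)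
qed

lemma gauss_cexp_prod:
  "complex_of_real (gauss x) * exp (\<i> * complex_of_real (- 2 * pi * (x \<bullet> z)))
    = (\<Prod>b\<in>Basis. complex_of_real (exp (- (x \<bullet> b)\<^sup>2 / 2)) *
        exp (\<i> * complex_of_real (- 2 * pi * ((x \<bullet> b) * (z \<bullet> b)))))"
proof -
  have "exp (\<i> * complex_of_real (- 2 * pi * (x \<bullet> z)))
      = exp (\<Sum>b\<in>Basis. \<i> * complex_of_real (- 2 * pi * ((x \<bullet> b) * (z \<bullet> b))))"
    by (subst euclidean_inner) (simp add: sum_distrib_left)
  then show ?thesis
    by (simp add: gauss_prod prod.distrib exp_sum)
qed

lemma fourier_gauss: "fourier (\<lambda>w. complex_of_real (gauss w)) z = fourier_gauss z"
  unfolding fourier_cexp gauss_cexp_prod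
  by (subst integral_lborel_prod) (simp_all only: fourier_gauss_1D fourier_gauss_def of_real_prod)

lemma integrable_gauss: "integrable lborel (gauss :: 'a::euclidean_space \<Rightarrow> real)"
proof -
  \<comment> \<open>At frequency 0 the exponential factor is 1, so the product form gives
    integrability of the Gaussian itself.\<close>
  have "integrable lborel (\<lambda>x::'a. complex_of_real (gauss x) * exp (\<i> * complex_of_real (- 2 * pi * (x \<bullet> 0))))"
    unfolding gauss_cexp_prod by (intro integrable_lborel_prod fourier_gauss_1D)
  then show ?thesis
    by (simp add: complex_of_real_integrable_eq)
qed

lemma fourier_gauss_nonneg: "0 \<le> fourier_gauss z"
  by (simp add: fourier_gauss_def prod_nonneg)

lemma
  shows integrable_fourier_gauss: "integrable lborel (fourier_gauss :: 'a::euclidean_space \<Rightarrow> real)"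
    and integral_fourier_gauss: "(LINT z|lborel. fourier_gauss (z :: 'a)) = 1"
proof -
  have i: "integrable lborel (\<lambda>z. complex_of_real (normal_density 0 (1 / (2 * pi)) z))"
    by (simp add: complex_of_real_integrable_eq)
  have "integrable lborel (\<lambda>z::'a. complex_of_real (fourier_gauss z))"
    unfolding fourier_gauss_def of_real_prod by (intro integrable_lborel_prod i)
  then show "integrable lborel (fourier_gauss :: 'a \<Rightarrow> real)"
    by (simp add: complex_of_real_integrable_eq)
  have "(LINT z|lborel. complex_of_real (fourier_gauss (z :: 'a))) = 1"
    unfolding fourier_gauss_def of_real_prod
    by (subst integral_lborel_prod[OF i]) simp
  then show "(LINT z|lborel. fourier_gauss (z :: 'a)) = 1"
    using of_real_eq_1_iff by simp
qed

lemma gauss_nonneg: "0 \<le> gauss w"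
  by (simp add: gauss_def)

lemma gauss_measurable [measurable]: "gauss \<in> borel_measurable borel"
  unfolding gauss_def[abs_def] by measurable

lemma fourier_gauss_measurable [measurable]: "fourier_gauss \<in> borel_measurable borel"
  using borel_measurable_integrable[OF integrable_fourier_gauss] by simp

section \<open>Fourier transforms of integrable functions\<close>

lemma cnj_measurable [measurable]: "cnj \<in> borel_measurable borel"
  by (intro borel_measurable_continuous_onI continuous_intros)

lemma fourier_measurable [measurable]:
  assumes [measurable]: "f \<in> borel_measurable borel"
  shows "fourier f \<in> borel_measurable borel"
  unfolding fourier_cexp[abs_def] by measurable

lemma integrable_mult_cexp:
  assumes "integrable lborel f"
  shows "integrable lborel (\<lambda>x. f x * exp (\<i> * complex_of_real (- 2 * pi * (x \<bullet> w))))"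
proof -
  have [measurable]: "f \<in> borel_measurable borel"
    using assms by auto
  show ?thesis
    by (rule Bochner_Integration.integrable_bound[OF assms]) (auto simp: norm_mult)
qed

lemma cmod_fourier_le:
  assumes "integrable lborel f"
  shows "cmod (fourier f w) \<le> (LINT x|lborel. cmod (f x))"
  using integral_norm_bound[of lborel "\<lambda>x. f x * exp (\<i> * complex_of_real (- 2 * pi * (x \<bullet> w)))"]
  unfolding fourier_cexp by (simp add: norm_mult)

lemma fourier_translate: "fourier (translate s f) w = exp (\<i> * complex_of_real (- 2 * pi * (s \<bullet> w))) * fourier f w"
proof -
  have "fourier (translate s f) w
      = (LINT x|lborel. exp (\<i> * complex_of_real (- 2 * pi * (s \<bullet> w))) *
          (f (x - s) * exp (\<i> * complex_of_real (- 2 * pi * ((x - s) \<bullet> w)))))"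
    unfolding fourier_cexp translate_def
    by (intro Bochner_Integration.integral_cong)
      (auto simp: inner_diff_left algebra_simps simp flip: exp_add)
  also have "\<dots> = exp (\<i> * complex_of_real (- 2 * pi * (s \<bullet> w))) * fourier f w"
    unfolding fourier_cexp integral_mult_right_zero
    using integral_lborel_translate[of "\<lambda>x. f x * exp (\<i> * complex_of_real (- 2 * pi * (x \<bullet> w)))" s] by simp
  finally show ?thesis .
qed

lemma fourier_diff:
  assumes "integrable lborel f" "integrable lborel g"
  shows "fourier (\<lambda>x. f x - g x) w = fourier f w - fourier g w"
  using Bochner_Integration.integral_diff[OF integrable_mult_cexp[OF assms(1)] integrable_mult_cexp[OF assms(2)], of w w]
  unfolding fourier_cexp by (simp add: algebra_simps)

text \<open>Conjugation undoes the sign change of the reflection and leaves only the phase of the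
  shift x. In \<open>gauss_energy_eq\<close> this presents a conjugate transform times a character
  as a transform again, so that the multiplication formula applies.\<close>

lemma fourier_cnj_reflect:
  "fourier (\<lambda>y. cnj (h (x - y))) w
    = exp (\<i> * complex_of_real (- 2 * pi * (x \<bullet> w))) * cnj (fourier h w)"
proof -
  have "fourier (\<lambda>y. cnj (h (x - y))) w
      = (LINT y|lborel. exp (\<i> * complex_of_real (- 2 * pi * (x \<bullet> w))) *
          cnj (h (x - y) * exp (\<i> * complex_of_real (- 2 * pi * ((x - y) \<bullet> w)))))"
    unfolding fourier_cexp
    by (intro Bochner_Integration.integral_cong)
      (auto simp: inner_diff_left exp_cnj algebra_simps simp flip: exp_add)
  also have "\<dots> = exp (\<i> * complex_of_real (- 2 * pi * (x \<bullet> w))) * cnj (fourier h w)"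
    unfolding fourier_cexp integral_mult_right_zero Bochner_Integration.integral_cnj
    using integral_lborel_reflect[of "\<lambda>y. h y * exp (\<i> * complex_of_real (- 2 * pi * (y \<bullet> w)))" x]
    by simp
  finally show ?thesis .
qed

lemma integrable_pair_mult:
  fixes f g :: "'a::euclidean_space \<Rightarrow> complex"
  assumes "integrable lborel f" "integrable lborel g"
  shows "integrable (lborel \<Otimes>\<^sub>M lborel) (\<lambda>(x, y). f x * g y)"
proof -
  have [measurable]: "f \<in> borel_measurable borel" "g \<in> borel_measurable borel"
    using assms by auto
  show ?thesis
  proof (rule lborel_pair.Fubini_integrable)
    show "AE x in lborel. integrable lborel (\<lambda>y. case (x, y) of (x, y) \<Rightarrow> f x * g y)"
      using assms by auto
  qed (use assms in \<open>auto simp: norm_mult\<close>)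
qed

text \<open>Both sides are iterated integrals of \<open>f x * g w\<close> times a character that is
  symmetric in x and w. The character has modulus 1, so Fubini applies.\<close>

lemma fourier_multiplication_formula:
  fixes f g :: "'a::euclidean_space \<Rightarrow> complex"
  assumes "integrable lborel f" "integrable lborel g"
  shows "(LINT w|lborel. fourier f w * g w) = (LINT x|lborel. f x * fourier g x)"
proof -
  have [measurable]: "f \<in> borel_measurable borel" "g \<in> borel_measurable borel"
    using assms by auto
  let ?e = "\<lambda>x w :: 'a. exp (\<i> * complex_of_real (- 2 * pi * (x \<bullet> w)))"
  have i: "integrable (lborel \<Otimes>\<^sub>M lborel) (\<lambda>(x, w). f x * g w * ?e x w)"
    by (rule Bochner_Integration.integrable_bound[OF integrable_pair_mult[OF assms]])
      (auto simp: norm_mult)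
  have "(LINT w|lborel. fourier f w * g w) = (LINT w|lborel. (LINT x|lborel. f x * g w * ?e x w))"
    unfolding fourier_cexp integral_mult_left_zero[symmetric]
    by (simp add: mult_ac)
  also have "\<dots> = (LINT x|lborel. (LINT w|lborel. f x * g w * ?e x w))"
    using lborel_pair.Fubini_integral[OF i] by simp
  also have "\<dots> = (LINT x|lborel. f x * fourier g x)"
    unfolding fourier_cexp integral_mult_right_zero[symmetric]
    by (simp add: mult_ac inner_commute)
  finally show ?thesis .
qed

section \<open>Convolution of integrable functions\<close>

lemma conv_measurable [measurable]:
  assumes [measurable]: "f \<in> borel_measurable borel" "g \<in> borel_measurable borel"
  shows "conv f g \<in> borel_measurable borel"
  unfolding conv_def[abs_def] by measurable

lemma conv_translate_left: "conv (translate s f) g = translate s (conv f g)"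
proof
  fix y
  show "conv (translate s f) g y = translate s (conv f g) y"
    using integral_lborel_translate[of "\<lambda>x. f x * g (y - s - x)" s]
    by (simp add: conv_def translate_def algebra_simps)
qed

lemma integrable_pair_conv:
  fixes f g :: "'a::euclidean_space \<Rightarrow> complex"
  assumes "integrable lborel f" "integrable lborel g"
  shows "integrable (lborel \<Otimes>\<^sub>M lborel) (\<lambda>(x, y). f x * g (y - x))"
proof -
  have [measurable]: "f \<in> borel_measurable borel" "g \<in> borel_measurable borel"
    using assms by auto
  show ?thesis
  proof (rule lborel_pair.Fubini_integrable)
    show "AE x in lborel. integrable lborel (\<lambda>y. case (x, y) of (x, y) \<Rightarrow> f x * g (y - x))"
      using assms by (auto simp: integrable_lborel_translate)
  qed (use assms in \<open>auto simp: norm_mult integral_lborel_translate[of "\<lambda>x. cmod (g x)"]\<close>)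
qed

lemma integrable_conv:
  assumes "integrable lborel f" "integrable lborel g"
  shows "integrable lborel (conv f g)"
  using lborel_pair.integrable_snd[OF integrable_pair_conv[OF assms]]
  by (simp add: conv_def[abs_def])

lemma fourier_conv:
  fixes f g :: "'a::euclidean_space \<Rightarrow> complex"
  assumes "integrable lborel f" "integrable lborel g"
  shows "fourier (conv f g) w = fourier f w * fourier g w"
proof -
  have [measurable]: "f \<in> borel_measurable borel" "g \<in> borel_measurable borel"
    using assms by auto
  let ?e = "\<lambda>x :: 'a. exp (\<i> * complex_of_real (- 2 * pi * (x \<bullet> w)))"
  have i: "integrable (lborel \<Otimes>\<^sub>M lborel) (\<lambda>(x, y). f x * g (y - x) * ?e y)"
    by (rule Bochner_Integration.integrable_bound[OF integrable_pair_conv[OF assms]])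
      (auto simp: norm_mult)
  have "fourier (conv f g) w = (LINT y|lborel. (LINT x|lborel. f x * g (y - x) * ?e y))"
    by (simp add: fourier_cexp conv_def)
  also have "\<dots> = (LINT x|lborel. (LINT y|lborel. f x * g (y - x) * ?e y))"
    using lborel_pair.Fubini_integral[OF i] by simp
  also have "\<dots> = (LINT x|lborel. f x * fourier (translate x g) w)"
    unfolding fourier_cexp integral_mult_right_zero[symmetric]
    by (simp add: mult_ac translate_def)
  also have "\<dots> = (LINT x|lborel. f x * ?e x * fourier g w)"
    by (simp only: fourier_translate mult_ac)
  also have "\<dots> = fourier f w * fourier g w"
    unfolding fourier_cexp by simp
  finally show ?thesis .
qed

text \<open>Dilating the Gaussian by r rescales its transform by 1 / r, and the substitution x = r v
  removes the scaling together with the factor r^d. For a non-integrable integrand both sides take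
  the default value 0, so p may be arbitrary.\<close>

lemma fourier_gauss_scaled:
  fixes p :: "'a::euclidean_space \<Rightarrow> complex"
  assumes "r > 0"
  shows "(LINT x|lborel. p x * fourier (\<lambda>w. complex_of_real (gauss (r *\<^sub>R w))) x)
    = (LINT v|lborel. p (r *\<^sub>R v) * complex_of_real (fourier_gauss v))"
proof -
  have "fourier (\<lambda>w. complex_of_real (gauss (r *\<^sub>R w))) x
      = complex_of_real (fourier_gauss ((1 / r) *\<^sub>R x)) / complex_of_real (r ^ DIM('a))" for x :: 'a
    using integral_affine[of r "\<lambda>w. complex_of_real (gauss w) *
        exp (\<i> * complex_of_real (- 2 * pi * (w \<bullet> ((1 / r) *\<^sub>R x))))" 0] assms
    unfolding fourier_gauss[symmetric] fourier_cexp
    by (simp add: scaleR_conv_of_real)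
  then have "(LINT x|lborel. p x * fourier (\<lambda>w. complex_of_real (gauss (r *\<^sub>R w))) x)
      = (LINT x|lborel. p x * complex_of_real (fourier_gauss ((1 / r) *\<^sub>R x)) / complex_of_real (r ^ DIM('a)))"
    by simp
  also have "\<dots> = (LINT v|lborel. p (r *\<^sub>R v) * complex_of_real (fourier_gauss v))"
    using integral_affine[of r "\<lambda>x. p x * complex_of_real (fourier_gauss ((1 / r) *\<^sub>R x))" 0] assms
    by (simp add: scaleR_conv_of_real)
  finally show ?thesis .
qed

section \<open>Gaussian-damped energy of a Fourier transform\<close>

definition gauss_energy :: "real \<Rightarrow> ('a::euclidean_space \<Rightarrow> complex) \<Rightarrow> real" where
  "gauss_energy r h = (LINT w|lborel. (cmod (fourier h w))\<^sup>2 * gauss (r *\<^sub>R w))"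

lemma integrable_gauss_scaled:
  "r > 0 \<Longrightarrow> integrable lborel (\<lambda>w::'a::euclidean_space. gauss (r *\<^sub>R w))"
  using integrable_affine[OF integrable_gauss, of r 0] by simp

lemma integrable_gauss_energy:
  assumes h: "integrable lborel h" and r: "r > 0"
  shows "integrable lborel (\<lambda>w. (cmod (fourier h w))\<^sup>2 * gauss (r *\<^sub>R w))"
proof -
  have [measurable]: "h \<in> borel_measurable borel"
    using h by auto
  have "integrable lborel (\<lambda>w. (LINT x|lborel. cmod (h x))\<^sup>2 * gauss (r *\<^sub>R w))"
    by (intro integrable_mult_right integrable_gauss_scaled r)
  then show ?thesis
    by (rule Bochner_Integration.integrable_bound)
      (auto simp: abs_mult gauss_nonneg intro!: mult_right_mono power_mono cmod_fourier_le[OF h])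
qed

text \<open>Two uses of the multiplication formula move both transforms off h. What remains pairs h
  with an average of its translates under the Gaussian density at scale r, a form free of transforms
  of h in which bounds and limits can be read off.\<close>

lemma gauss_energy_eq:
  fixes h :: "'a::euclidean_space \<Rightarrow> complex"
  assumes h: "integrable lborel h" and r: "r > 0"
  shows "complex_of_real (gauss_energy r h) =
    (LINT x|lborel. h x * (LINT v|lborel. cnj (h (x - r *\<^sub>R v)) * complex_of_real (fourier_gauss v)))"
proof -
  have [measurable]: "h \<in> borel_measurable borel"
    using h by auto
  define p where "p x = (\<lambda>y. cnj (h (x - y)))" for x
  have p: "integrable lborel (p x)" for x
    using h by (simp add: p_def integrable_lborel_reflect)
  have g: "integrable lborel (\<lambda>w::'a. complex_of_real (gauss (r *\<^sub>R w)))"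
    using integrable_gauss_scaled[OF r] by (simp add: complex_of_real_integrable_eq)
  \<comment> \<open>The weight joins the conjugate transform, which makes the energy the integral of
    \<open>fourier h w * \<phi> w\<close> with both h and \<open>\<phi>\<close> integrable.\<close>
  define \<phi> where "\<phi> w = cnj (fourier h w) * complex_of_real (gauss (r *\<^sub>R w))" for w
  have "integrable lborel (\<lambda>w. complex_of_real (LINT x|lborel. cmod (h x)) * complex_of_real (gauss (r *\<^sub>R (w::'a))))"
    by (intro integrable_mult_right g)
  then have \<phi>: "integrable lborel \<phi>"
    unfolding \<phi>_def[abs_def]
    by (rule Bochner_Integration.integrable_bound)
      (auto simp: norm_mult gauss_nonneg intro!: mult_right_mono
        intro: order_trans[OF cmod_fourier_le[OF h]])
  have *: "fourier \<phi> x = (LINT v|lborel. cnj (h (x - r *\<^sub>R v)) * complex_of_real (fourier_gauss v))" for x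
  proof -
    have "fourier \<phi> x = (LINT w|lborel. fourier (p x) w * complex_of_real (gauss (r *\<^sub>R w)))"
      unfolding p_def fourier_cnj_reflect
      by (subst fourier_cexp) (simp add: \<phi>_def mult_ac inner_commute)
    also have "\<dots> = (LINT y|lborel. p x y * fourier (\<lambda>w. complex_of_real (gauss (r *\<^sub>R w))) y)"
      by (rule fourier_multiplication_formula[OF p g])
    also have "\<dots> = (LINT v|lborel. p x (r *\<^sub>R v) * complex_of_real (fourier_gauss v))"
      by (rule fourier_gauss_scaled[OF r])
    finally show ?thesis
      by (simp add: p_def)
  qed
  have "complex_of_real (gauss_energy r h) = (LINT w|lborel. fourier h w * \<phi> w)"
    unfolding gauss_energy_def integral_complex_of_real[symmetric] \<phi>_def
    by (simp add: complex_norm_square mult.assoc del: of_real_power)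
  also have "\<dots> = (LINT x|lborel. h x * fourier \<phi> x)"
    by (rule fourier_multiplication_formula[OF h \<phi>])
  finally show ?thesis
    unfolding * .
qed

section \<open>Gaussian-damped energy and translation continuity\<close>

lemma norm_integral_le_nn_integral:
  fixes f :: "'b \<Rightarrow> 'c::{banach, second_countable_topology}"
  shows "ennreal (norm (integral\<^sup>L M f)) \<le> (\<integral>\<^sup>+x. norm (f x) \<partial>M)"
  using integral_norm_bound_ennreal[of M f]
  by (cases "integrable M f") (auto simp: not_integrable_integral_eq)

lemma nn_integral_fourier_gauss: "(\<integral>\<^sup>+z. ennreal (fourier_gauss (z::'a::euclidean_space)) \<partial>lborel) = 1"
  by (simp add: nn_integral_eq_integral integrable_fourier_gauss fourier_gauss_nonneg integral_fourier_gauss)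

text \<open>In the form of \<open>gauss_energy_eq\<close>, the product |h(x)| |h(x - r v)| is at
  most half the sum of the squares. Each half integrates to half the energy of h, as translation
  preserves the energy and \<open>fourier_gauss\<close> has mass 1. With values in
  \<open>ennreal\<close> this covers h of infinite energy too.\<close>

lemma gauss_energy_le:
  fixes h :: "'a::euclidean_space \<Rightarrow> complex"
  assumes h: "integrable lborel h" and r: "r > 0"
  shows "ennreal (gauss_energy r h) \<le> (\<integral>\<^sup>+x. (cmod (h x))\<^sup>2 \<partial>lborel)"
proof -
  have [measurable]: "h \<in> borel_measurable borel"
    using h by auto
  let ?E = "\<integral>\<^sup>+x. ennreal ((cmod (h x))\<^sup>2 / 2) \<partial>lborel"
  have "gauss_energy r h \<le> cmod (complex_of_real (gauss_energy r h))"
    by simp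
  then have "ennreal (gauss_energy r h)
      \<le> ennreal (norm (LINT x|lborel. h x * (LINT v|lborel. cnj (h (x - r *\<^sub>R v)) * complex_of_real (fourier_gauss v))))"
    unfolding gauss_energy_eq[OF h r] by (rule ennreal_leI)
  also have "\<dots> \<le> (\<integral>\<^sup>+x. norm (h x * (LINT v|lborel. cnj (h (x - r *\<^sub>R v)) * complex_of_real (fourier_gauss v))) \<partial>lborel)"
    by (rule norm_integral_le_nn_integral)
  also have "\<dots> \<le> (\<integral>\<^sup>+x. (\<integral>\<^sup>+v. ennreal (cmod (h x) * (cmod (h (x - r *\<^sub>R v)) * fourier_gauss v)) \<partial>lborel) \<partial>lborel)"
  proof (rule nn_integral_mono)
    fix x
    have "ennreal (norm (h x * (LINT v|lborel. cnj (h (x - r *\<^sub>R v)) * complex_of_real (fourier_gauss v))))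
       = ennreal (cmod (h x)) * ennreal (norm (LINT v|lborel. cnj (h (x - r *\<^sub>R v)) * complex_of_real (fourier_gauss v)))"
      by (simp add: norm_mult ennreal_mult)
    also have "\<dots> \<le> ennreal (cmod (h x)) * (\<integral>\<^sup>+v. norm (cnj (h (x - r *\<^sub>R v)) * complex_of_real (fourier_gauss v)) \<partial>lborel)"
      by (intro mult_left_mono norm_integral_le_nn_integral) simp
    also have "\<dots> = (\<integral>\<^sup>+v. ennreal (cmod (h x) * (cmod (h (x - r *\<^sub>R v)) * fourier_gauss v)) \<partial>lborel)"
      by (simp add: norm_mult ennreal_mult fourier_gauss_nonneg nn_integral_cmult)
    finally show "ennreal (norm (h x * (LINT v|lborel. cnj (h (x - r *\<^sub>R v)) * complex_of_real (fourier_gauss v)))) \<le> \<dots>" .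
  qed
  also have "\<dots> \<le> (\<integral>\<^sup>+x. (\<integral>\<^sup>+v. ennreal ((cmod (h x))\<^sup>2 / 2) * ennreal (fourier_gauss v)
      + ennreal ((cmod (h (x - r *\<^sub>R v)))\<^sup>2 / 2) * ennreal (fourier_gauss v) \<partial>lborel) \<partial>lborel)"
  proof (intro nn_integral_mono)
    fix x v :: 'a
    have "cmod (h x) * cmod (h (x - r *\<^sub>R v)) \<le> (cmod (h x))\<^sup>2 / 2 + (cmod (h (x - r *\<^sub>R v)))\<^sup>2 / 2"
      using sum_squares_bound[of "cmod (h x)" "cmod (h (x - r *\<^sub>R v))"] by simp
    then have "cmod (h x) * cmod (h (x - r *\<^sub>R v)) * fourier_gauss v
        \<le> ((cmod (h x))\<^sup>2 / 2 + (cmod (h (x - r *\<^sub>R v)))\<^sup>2 / 2) * fourier_gauss v"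
      by (rule mult_right_mono) (rule fourier_gauss_nonneg)
    then show "ennreal (cmod (h x) * (cmod (h (x - r *\<^sub>R v)) * fourier_gauss v))
      \<le> ennreal ((cmod (h x))\<^sup>2 / 2) * ennreal (fourier_gauss v)
        + ennreal ((cmod (h (x - r *\<^sub>R v)))\<^sup>2 / 2) * ennreal (fourier_gauss v)"
      by (simp add: fourier_gauss_nonneg algebra_simps flip: ennreal_mult ennreal_plus)
  qed
  also have "\<dots> = (\<integral>\<^sup>+x. (\<integral>\<^sup>+v. ennreal ((cmod (h x))\<^sup>2 / 2) * ennreal (fourier_gauss (v::'a)) \<partial>lborel) \<partial>lborel)
      + (\<integral>\<^sup>+x. (\<integral>\<^sup>+v. ennreal ((cmod (h (x - r *\<^sub>R v)))\<^sup>2 / 2) * ennreal (fourier_gauss v) \<partial>lborel) \<partial>lborel)"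
    by (simp add: nn_integral_add)
  also have "(\<integral>\<^sup>+x. (\<integral>\<^sup>+v. ennreal ((cmod (h x))\<^sup>2 / 2) * ennreal (fourier_gauss (v::'a)) \<partial>lborel) \<partial>lborel) = ?E"
    by (simp add: nn_integral_cmult nn_integral_fourier_gauss)
  also have "(\<integral>\<^sup>+x. (\<integral>\<^sup>+v. ennreal ((cmod (h (x - r *\<^sub>R v)))\<^sup>2 / 2) * ennreal (fourier_gauss v) \<partial>lborel) \<partial>lborel)
      = (\<integral>\<^sup>+v. (\<integral>\<^sup>+x. ennreal ((cmod (h (x - r *\<^sub>R v)))\<^sup>2 / 2) * ennreal (fourier_gauss v) \<partial>lborel) \<partial>lborel)"
    by (rule lborel_pair.Fubini') measurable
  also have "\<dots> = (\<integral>\<^sup>+v. ?E * ennreal (fourier_gauss (v::'a)) \<partial>lborel)"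
    by (simp add: nn_integral_multc nn_integral_lborel_translate[of "\<lambda>x. ennreal ((cmod (h x))\<^sup>2 / 2)"])
  also have "\<dots> = ?E"
    by (simp add: nn_integral_cmult nn_integral_fourier_gauss)
  also have "?E + ?E = (\<integral>\<^sup>+x. (cmod (h x))\<^sup>2 \<partial>lborel)"
    by (simp flip: nn_integral_add ennreal_plus)
  finally show ?thesis .
qed

text \<open>The averages in \<open>gauss_energy_eq\<close> tend to \<open>cnj (h x)\<close> by
  continuity and are bounded by M. Dominated convergence applies first to the average, with majorant
  \<open>M * fourier_gauss v\<close>, and then to the pairing with h, with majorant
  \<open>cmod (h x) * M\<close>.\<close>

lemma tendsto_gauss_energy:
  fixes h :: "'a::euclidean_space \<Rightarrow> complex"
  assumes h: "integrable lborel h" and cont: "continuous_on UNIV h" and bd: "\<And>x. cmod (h x) \<le> M"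
  shows "(\<lambda>n. gauss_energy (1 / real (Suc n)) h) \<longlonglongrightarrow> (LINT x|lborel. (cmod (h x))\<^sup>2)"
proof -
  have [measurable]: "h \<in> borel_measurable borel"
    using h by auto
  have M: "M \<ge> 0"
    using bd[of 0] norm_ge_zero[of "h 0"] by linarith
  define I where "I n x = (LINT v|lborel. cnj (h (x - (1 / real (Suc n)) *\<^sub>R v)) * complex_of_real (fourier_gauss v))" for n x
  have iG: "integrable lborel (\<lambda>v::'a. M * fourier_gauss v)"
    by (intro integrable_mult_right integrable_fourier_gauss)
  have [measurable]: "I n \<in> borel_measurable borel" for n
    unfolding I_def[abs_def] by measurable
  have I_lim: "(\<lambda>n. I n x) \<longlonglongrightarrow> cnj (h x)" for x
  proof -
    have "(\<lambda>n. I n x) \<longlonglongrightarrow> (LINT v|lborel. cnj (h x) * complex_of_real (fourier_gauss (v::'a)))"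
      unfolding I_def
    proof (rule integral_dominated_convergence[OF _ _ iG])
      show "AE v in lborel. (\<lambda>n. cnj (h (x - (1 / real (Suc n)) *\<^sub>R v)) * complex_of_real (fourier_gauss v))
          \<longlonglongrightarrow> cnj (h x) * complex_of_real (fourier_gauss v)"
      proof (rule AE_I2)
        fix v
        have "(\<lambda>n. x - (1 / real (Suc n)) *\<^sub>R v) \<longlonglongrightarrow> x - 0 *\<^sub>R v"
          using LIMSEQ_inverse_real_of_nat by (intro tendsto_intros) (simp add: inverse_eq_divide)
        then have "(\<lambda>n. h (x - (1 / real (Suc n)) *\<^sub>R v)) \<longlonglongrightarrow> h x"
          using cont by (intro isCont_tendsto_compose[of x h]) (auto simp: continuous_on_eq_continuous_at)
        then show "(\<lambda>n. cnj (h (x - (1 / real (Suc n)) *\<^sub>R v)) * complex_of_real (fourier_gauss v))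
          \<longlonglongrightarrow> cnj (h x) * complex_of_real (fourier_gauss v)"
          by (intro tendsto_intros)
      qed
    qed (auto simp: norm_mult fourier_gauss_nonneg bd intro!: mult_right_mono)
    then show ?thesis
      by (simp add: integral_fourier_gauss)
  qed
  have I_bd: "cmod (I n x) \<le> M" for n x
  proof -
    have "integrable lborel (\<lambda>v. cnj (h (x - (1 / real (Suc n)) *\<^sub>R v)) * complex_of_real (fourier_gauss v))"
      by (rule Bochner_Integration.integrable_bound[OF iG])
        (use M in \<open>auto simp: norm_mult fourier_gauss_nonneg bd intro!: mult_right_mono\<close>)
    then have "cmod (I n x) \<le> (LINT v|lborel. M * fourier_gauss (v::'a))"
      unfolding I_def
      by (rule Bochner_Integration.integral_norm_bound_integral[OF _ iG])
        (auto simp: norm_mult fourier_gauss_nonneg bd intro!: mult_right_mono)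
    then show ?thesis
      by (simp add: integral_fourier_gauss)
  qed
  have "(\<lambda>n. LINT x|lborel. h x * I n x) \<longlonglongrightarrow> (LINT x|lborel. h x * cnj (h x))"
  proof (rule integral_dominated_convergence)
    show "integrable lborel (\<lambda>x. cmod (h x) * M)"
      using h by simp
  qed (auto simp: norm_mult intro!: mult_left_mono I_bd tendsto_intros I_lim)
  then have "(\<lambda>n. complex_of_real (gauss_energy (1 / real (Suc n)) h))
      \<longlonglongrightarrow> complex_of_real (LINT x|lborel. (cmod (h x))\<^sup>2)"
    unfolding integral_complex_of_real[symmetric]
    by (simp add: gauss_energy_eq[OF h] I_def complex_norm_square del: of_real_power)
  then show ?thesis
    by (simp only: tendsto_of_real_iff)
qed

section \<open>Continuity of translation in L1\<close>

lemma continuous_translation_L1_approx: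
  fixes f g :: "'a::euclidean_space \<Rightarrow> complex"
  assumes f: "integrable lborel f" and g: "integrable lborel g"
  shows "(LINT x|lborel. cmod (f (x - z) - f x))
    \<le> (LINT x|lborel. cmod (g (x - z) - g x)) + 2 * (LINT x|lborel. cmod (f x - g x))"
proof -
  have [simp]: "integrable lborel (\<lambda>x. f (x - z))" "integrable lborel (\<lambda>x. g (x - z))"
    using f g by (simp_all add: integrable_lborel_translate)
  have "(LINT x|lborel. cmod (f (x - z) - f x))
    \<le> (LINT x|lborel. cmod (g (x - z) - g x) + cmod (f (x - z) - g (x - z)) + cmod (f x - g x))"
  proof (rule integral_mono)
    fix x
    have "f (x - z) - f x = (g (x - z) - g x) + (f (x - z) - g (x - z)) - (f x - g x)"
      by simp
    then show "cmod (f (x - z) - f x) \<le> cmod (g (x - z) - g x) + cmod (f (x - z) - g (x - z)) + cmod (f x - g x)"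
      by (metis norm_triangle_ineq norm_triangle_ineq4 order_trans add_right_mono)
  qed (use f g in auto)
  also have "\<dots> = (LINT x|lborel. cmod (g (x - z) - g x)) + (LINT x|lborel. cmod (f (x - z) - g (x - z)))
      + (LINT x|lborel. cmod (f x - g x))"
    using f g by simp
  \<comment> \<open>The error of the approximation enters at x - z and at x with the same integral,
    hence the factor 2.\<close>
  also have "(LINT x|lborel. cmod (f (x - z) - g (x - z))) = (LINT x|lborel. cmod (f x - g x))"
    by (rule integral_lborel_translate)
  finally show ?thesis
    by simp
qed

text \<open>Functions on which translation along z is continuous form a closed subset of
  \<open>L1\<close>. The induction in \<open>continuous_translation_L1\<close> uses this to pass
  from open to measurable sets and from an approximating sequence to its limit.\<close>

lemma continuous_translation_L1_dense:
  fixes f :: "'a::euclidean_space \<Rightarrow> complex"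
  assumes f: "integrable lborel f"
    and approx: "\<And>e. e > 0 \<Longrightarrow> \<exists>g. integrable lborel g \<and> (LINT x|lborel. cmod (f x - g x)) < e \<and>
      (\<lambda>n. LINT x|lborel. cmod (g (x - z n) - g x)) \<longlonglongrightarrow> 0"
  shows "(\<lambda>n. LINT x|lborel. cmod (f (x - z n) - f x)) \<longlonglongrightarrow> 0"
proof (rule LIMSEQ_I)
  fix e :: real
  assume "e > 0"
  then obtain g where g: "integrable lborel g" "(LINT x|lborel. cmod (f x - g x)) < e / 3"
    and lim: "(\<lambda>n. LINT x|lborel. cmod (g (x - z n) - g x)) \<longlonglongrightarrow> 0"
    using approx[of "e / 3"] by auto
  obtain N where N: "\<And>n. n \<ge> N \<Longrightarrow> norm ((LINT x|lborel. cmod (g (x - z n) - g x)) - 0) < e / 3"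
    using LIMSEQ_D[OF lim, of "e / 3"] \<open>e > 0\<close> by auto
  show "\<exists>N. \<forall>n\<ge>N. norm ((LINT x|lborel. cmod (f (x - z n) - f x)) - 0) < e"
  proof (intro exI allI impI)
    fix n
    assume "N \<le> n"
    then show "norm ((LINT x|lborel. cmod (f (x - z n) - f x)) - 0) < e"
      using N[of n] g(2) continuous_translation_L1_approx[OF f g(1), of "z n"] by simp
  qed
qed

text \<open>Openness controls x - z n only for x in U, and the symmetric differences of U with its
  translates need not have a common integrable majorant. They equal the difference of the two
  indicators, whose integral vanishes, plus twice the part \<open>D n\<close> of U that the
  translate misses; \<open>D n\<close> is dominated by the indicator of U.\<close>

lemma continuous_translation_L1_open:
  fixes U :: "'a::euclidean_space set"
  assumes U: "open U" "emeasure lborel U < \<infinity>" and z: "z \<longlonglongrightarrow> 0"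
  shows "(\<lambda>n. LINT x|lborel. cmod (indicator U (x - z n) *\<^sub>R c - indicator U x *\<^sub>R c)) \<longlonglongrightarrow> 0"
proof -
  have [measurable]: "U \<in> sets borel"
    using U by simp
  have iU: "integrable lborel (indicator U :: 'a \<Rightarrow> real)"
    using U by (intro integrable_real_indicator) auto
  have iUt: "integrable lborel (\<lambda>x. indicator U (x - w) :: real)" for w
    using iU by (simp add: integrable_lborel_translate)
  define D where "D n x = (indicator U x * (1 - indicator U (x - z n)) :: real)" for n x
  have [measurable]: "D n \<in> borel_measurable borel" for n
    unfolding D_def[abs_def] by measurable
  have iD: "integrable lborel (D n)" for n
    by (rule Bochner_Integration.integrable_bound[OF iU]) (auto simp: D_def indicator_def)
  have "(LINT x|lborel. cmod (indicator U (x - z n) *\<^sub>R c - indicator U x *\<^sub>R c))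
      = cmod c * (2 * (LINT x|lborel. D n x))" for n
  proof -
    have "(LINT x|lborel. cmod (indicator U (x - z n) *\<^sub>R c - indicator U x *\<^sub>R c))
        = (LINT x|lborel. cmod c * (indicator U (x - z n) - indicator U x + 2 * D n x))"
      by (intro Bochner_Integration.integral_cong) (auto simp: D_def indicator_def)
    also have "\<dots> = cmod c * (2 * (LINT x|lborel. D n x))"
      using iU iUt iD integral_lborel_translate[of "indicator U :: 'a \<Rightarrow> real" "z n"] by simp
    finally show ?thesis .
  qed
  moreover have "(\<lambda>n. LINT x|lborel. D n x) \<longlonglongrightarrow> (LINT (x::'a)|lborel. (0::real))"
  proof (rule integral_dominated_convergence[OF _ _ iU])
    show "AE x in lborel. (\<lambda>n. D n x) \<longlonglongrightarrow> 0"
    proof (rule AE_I2)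
      fix x
      show "(\<lambda>n. D n x) \<longlonglongrightarrow> 0"
      proof (cases "x \<in> U")
        case True
        have "(\<lambda>n. x - z n) \<longlonglongrightarrow> x - 0"
          by (intro tendsto_intros z)
        then have "\<forall>\<^sub>F n in sequentially. x - z n \<in> U"
          using topological_tendstoD[of _ x sequentially U] U(1) True by simp
        then have "\<forall>\<^sub>F n in sequentially. D n x = 0"
          by eventually_elim (simp add: D_def)
        then show ?thesis
          by (rule tendsto_eventually)
      qed (simp add: D_def)
    qed
  qed (auto simp: D_def indicator_def)
  ultimately show ?thesis
    by (auto intro!: tendsto_eq_intros)
qed

lemma continuous_translation_L1:
  fixes f :: "'a::euclidean_space \<Rightarrow> complex"
  assumes "integrable lborel f" and z: "z \<longlonglongrightarrow> 0"
  shows "(\<lambda>n. LINT x|lborel. cmod (f (x - z n) - f x)) \<longlonglongrightarrow> 0"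
  using assms(1)
proof (induction rule: integrable_induct)
  case (base A c)
  then have [measurable]: "A \<in> sets borel" and "emeasure lborel A < \<infinity>"
    by auto
  then have iA: "integrable lborel (\<lambda>x. indicator A x *\<^sub>R c)"
    by (intro integrable_scaleR_left integrable_real_indicator) auto
  show ?case
  proof (rule continuous_translation_L1_dense[OF iA])
    fix e :: real
    assume e: "e > 0"
    \<comment> \<open>Adding 1 covers c = 0 and gives \<open>cmod c * d < e\<close>.\<close>
    define d where "d = e / (cmod c + 1)"
    have d: "d > 0" "cmod c * d < e"
      using e by (auto simp: d_def field_simps add_pos_nonneg)
    obtain U where U: "open U" "A \<subseteq> U" "emeasure lborel (U - A) < d"
      using outer_regular_lborel[of A d] d by auto
    then have [measurable]: "U \<in> sets borel"
      by simp
    have "emeasure lborel U = emeasure lborel A + emeasure lborel (U - A)"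
      using U(2) by (subst plus_emeasure) (auto simp: Un_absorb1)
    also have "\<dots> < \<infinity>"
      using U(3) \<open>emeasure lborel A < \<infinity>\<close> by (auto simp: less_top[symmetric])
    finally have fU: "emeasure lborel U < \<infinity>" .
    have "(LINT x|lborel. cmod (indicator A x *\<^sub>R c - indicator U x *\<^sub>R c))
        = (LINT x|lborel. cmod c * indicator (U - A) x)"
      using U(2) by (intro Bochner_Integration.integral_cong) (auto simp: indicator_def)
    also have "\<dots> = cmod c * measure lborel (U - A)"
      by simp
    also have "\<dots> \<le> cmod c * d"
      using U(3) d(1) by (intro mult_left_mono) (auto simp: measure_def enn2real_leI)
    finally have "(LINT x|lborel. cmod (indicator A x *\<^sub>R c - indicator U x *\<^sub>R c)) < e"
      using d(2) by simp
    moreover have "integrable lborel (\<lambda>x. indicator U x *\<^sub>R c)"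
      using fU by (intro integrable_scaleR_left integrable_real_indicator) auto
    ultimately show "\<exists>g. integrable lborel g \<and> (LINT x|lborel. cmod (indicator A x *\<^sub>R c - g x)) < e \<and>
      (\<lambda>n. LINT x|lborel. cmod (g (x - z n) - g x)) \<longlonglongrightarrow> 0"
      using continuous_translation_L1_open[OF U(1) fU z] by (intro exI[of _ "\<lambda>x. indicator U x *\<^sub>R c"]) auto
  qed
next
  case (add f g)
  have [simp]: "integrable lborel (\<lambda>x. f (x - w))" "integrable lborel (\<lambda>x. g (x - w))" for w
    using add by (simp_all add: integrable_lborel_translate)
  have "(\<lambda>n. (LINT x|lborel. cmod (f (x - z n) - f x)) + (LINT x|lborel. cmod (g (x - z n) - g x))) \<longlonglongrightarrow> 0 + 0"
    using add by (intro tendsto_intros)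
  then have sum_lim: "(\<lambda>n. (LINT x|lborel. cmod (f (x - z n) - f x)) + (LINT x|lborel. cmod (g (x - z n) - g x))) \<longlonglongrightarrow> 0"
    by simp
  have le: "(LINT x|lborel. cmod (f (x - z n) + g (x - z n) - (f x + g x)))
      \<le> (LINT x|lborel. cmod (f (x - z n) - f x)) + (LINT x|lborel. cmod (g (x - z n) - g x))" for n
  proof -
    have "(LINT x|lborel. cmod (f (x - z n) + g (x - z n) - (f x + g x)))
        \<le> (LINT x|lborel. cmod (f (x - z n) - f x) + cmod (g (x - z n) - g x))"
      using add by (intro integral_mono) (auto simp: add_diff_add norm_triangle_ineq)
    then show ?thesis
      using add by simp
  qed
  show ?case
    by (rule tendsto_sandwich[OF _ _ tendsto_const sum_lim]) (auto intro!: always_eventually le)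
next
  case (lim f s)
  then have [measurable]: "f \<in> borel_measurable borel" "\<And>i. s i \<in> borel_measurable borel"
    by auto
  have s_lim: "(\<lambda>i. s i x) \<longlonglongrightarrow> f x" and s_le: "cmod (s i x) \<le> 2 * cmod (f x)" for i x
    using lim by auto
  have *: "(\<lambda>i. LINT x|lborel. cmod (f x - s i x)) \<longlonglongrightarrow> (LINT (x::'a)|lborel. (0::real))"
  proof (rule integral_dominated_convergence)
    \<comment> \<open>The induction rule supplies \<open>cmod (s i x) \<le> 2 * cmod (f x)\<close>,
      so the difference is at most 1 + 2 times \<open>cmod (f x)\<close>.\<close>
    show "integrable lborel (\<lambda>x. 3 * cmod (f x))"
      using lim by simp
    show "AE x in lborel. (\<lambda>i. cmod (f x - s i x)) \<longlonglongrightarrow> 0"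
    proof (rule AE_I2)
      fix x
      have "(\<lambda>i. cmod (f x - s i x)) \<longlonglongrightarrow> cmod (f x - f x)"
        by (intro tendsto_intros s_lim)
      then show "(\<lambda>i. cmod (f x - s i x)) \<longlonglongrightarrow> 0"
        by simp
    qed
    show "AE x in lborel. norm (cmod (f x - s i x)) \<le> 3 * cmod (f x)" for i
    proof (rule AE_I2)
      fix x
      show "norm (cmod (f x - s i x)) \<le> 3 * cmod (f x)"
        using norm_triangle_ineq4[of "f x" "s i x"] s_le[of i x] by simp
    qed
  qed auto
  show ?case
  proof (rule continuous_translation_L1_dense[OF \<open>integrable lborel f\<close>])
    fix e :: real
    assume "e > 0"
    then obtain i where "(LINT x|lborel. cmod (f x - s i x)) < e"
      using order_tendstoD(2)[OF *, of e] by (auto simp: eventually_sequentially)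
    then show "\<exists>g. integrable lborel g \<and> (LINT x|lborel. cmod (f x - g x)) < e \<and>
      (\<lambda>n. LINT x|lborel. cmod (g (x - z n) - g x)) \<longlonglongrightarrow> 0"
      using lim by (intro exI[of _ "s i"]) auto
  qed
qed

section \<open>The norm of a convolution operator\<close>

lemma cmod_conv_le:
  fixes u k :: "'a::euclidean_space \<Rightarrow> complex"
  assumes u: "\<And>x. cmod (u x) \<le> N" and k: "integrable lborel k"
  shows "cmod (conv u k y) \<le> N * (LINT x|lborel. cmod (k x))"
proof -
  have N: "N \<ge> 0"
    using u[of 0] norm_ge_zero[of "u 0"] by linarith
  have "cmod (conv u k y) \<le> (LINT x|lborel. cmod (u x * k (y - x)))"
    unfolding conv_def by (rule integral_norm_bound)
  also have "\<dots> \<le> (LINT x|lborel. N * cmod (k (y - x)))"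
    using k N by (intro integral_mono') (auto simp: norm_mult integrable_lborel_reflect intro!: mult_right_mono u)
  also have "\<dots> = N * (LINT x|lborel. cmod (k x))"
    using integral_lborel_reflect[of "\<lambda>x. cmod (k x)" y] by simp
  finally show ?thesis .
qed

text \<open>Moving the argument translates the kernel, so the increment is itself a convolution of u
  with the increment of k. It is bounded by N times an L1 norm that tends to 0.\<close>

lemma continuous_conv:
  fixes u k :: "'a::euclidean_space \<Rightarrow> complex"
  assumes [measurable]: "u \<in> borel_measurable borel" and u: "\<And>x. cmod (u x) \<le> N"
    and k: "integrable lborel k"
  shows "continuous_on UNIV (conv u k)"
proof -
  have [measurable]: "k \<in> borel_measurable borel"
    using k by auto
  have i: "integrable lborel (\<lambda>x. u x * k (y - x))" for y
  proof (rule Bochner_Integration.integrable_bound)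
    show "integrable lborel (\<lambda>x. N * cmod (k (y - x)))"
      using k by (simp add: integrable_lborel_reflect)
    have "cmod (u x) * cmod (k (y - x)) \<le> \<bar>N * cmod (k (y - x))\<bar>" for x
      by (rule order_trans[OF mult_right_mono[OF u] abs_ge_self]) simp
    then show "AE x in lborel. norm (u x * k (y - x)) \<le> norm (N * cmod (k (y - x)))"
      by (simp add: norm_mult)
  qed measurable
  have "(\<lambda>n. conv u k (Y n)) \<longlonglongrightarrow> conv u k a" if Y: "Y \<longlonglongrightarrow> a" for Y a
  proof -
    define z where "z n = a - Y n" for n
    have z: "z \<longlonglongrightarrow> 0"
      unfolding z_def using tendsto_diff[OF tendsto_const Y, of a] by simp
    have le: "norm (conv u k (Y n) - conv u k a) \<le> N * (LINT x|lborel. cmod (k (x - z n) - k x))" for n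
    proof -
      let ?d = "\<lambda>x. k (x - z n) - k x"
      have "integrable lborel ?d"
        using k by (simp add: integrable_lborel_translate)
      moreover have "conv u k (Y n) - conv u k a = conv u ?d a"
        using Bochner_Integration.integral_diff[OF i i, of "Y n" a]
        by (simp add: conv_def z_def algebra_simps)
      ultimately show ?thesis
        using cmod_conv_le[of u N ?d a] u by simp
    qed
    have "(\<lambda>n. N * (LINT x|lborel. cmod (k (x - z n) - k x))) \<longlonglongrightarrow> N * 0"
      by (intro tendsto_mult tendsto_const continuous_translation_L1[OF k z])
    then have lim: "(\<lambda>n. N * (LINT x|lborel. cmod (k (x - z n) - k x))) \<longlonglongrightarrow> 0"
      by simp
    have "(\<lambda>n. conv u k (Y n) - conv u k a) \<longlonglongrightarrow> 0"
      by (rule Lim_null_comparison[OF always_eventually[OF allI[OF le]] lim])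
    then show ?thesis
      by (simp add: LIM_zero_iff)
  qed
  then show ?thesis
    by (auto simp: continuous_on_eq_continuous_at continuous_at_sequentially comp_def)
qed

text \<open>The damped energy of a convolution is compared on the Fourier side and the damping is then removed;
  this replaces Plancherel's theorem.\<close>

lemma conv_bound_bounded:
  fixes u k :: "'a::euclidean_space \<Rightarrow> complex"
  assumes u: "integrable lborel u" and bd: "\<And>x. cmod (u x) \<le> N"
    and k: "integrable lborel k" and C: "AE w in lborel. cmod (fourier k w) \<le> C" "C \<ge> 0"
  shows "(\<integral>\<^sup>+x. (cmod (conv u k x))\<^sup>2 \<partial>lborel) \<le> ennreal (C\<^sup>2) * (\<integral>\<^sup>+x. (cmod (u x))\<^sup>2 \<partial>lborel)"
proof -
  have [measurable]: "u \<in> borel_measurable borel" "k \<in> borel_measurable borel"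
    using u k by auto
  let ?h = "conv u k"
  define M where "M = N * (LINT x|lborel. cmod (k x))"
  have h: "integrable lborel ?h"
    by (rule integrable_conv[OF u k])
  have hM: "cmod (?h x) \<le> M" for x
    unfolding M_def by (rule cmod_conv_le[OF bd k])
  have ih: "integrable lborel (\<lambda>x. (cmod (?h x))\<^sup>2)"
  proof (rule Bochner_Integration.integrable_bound)
    show "integrable lborel (\<lambda>x. M * cmod (?h x))"
      using h by simp
    have "cmod (?h x) * cmod (?h x) \<le> \<bar>M * cmod (?h x)\<bar>" for x
      by (rule order_trans[OF mult_right_mono[OF hM] abs_ge_self]) simp
    then show "AE x in lborel. norm ((cmod (?h x))\<^sup>2) \<le> norm (M * cmod (?h x))"
      by (simp add: power2_eq_square)
  qed measurable
  have "gauss_energy r ?h \<le> C\<^sup>2 * gauss_energy r u" if r: "r > 0" for r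
    unfolding gauss_energy_def integral_mult_right_zero[symmetric]
  proof (rule integral_mono_AE)
    show "AE w in lborel. (cmod (fourier ?h w))\<^sup>2 * gauss (r *\<^sub>R w)
        \<le> C\<^sup>2 * ((cmod (fourier u w))\<^sup>2 * gauss (r *\<^sub>R w))"
      using C(1)
    proof eventually_elim
      case (elim w)
      then have "(cmod (fourier k w))\<^sup>2 \<le> C\<^sup>2"
        by (simp add: power_mono)
      then have "(cmod (fourier k w))\<^sup>2 * ((cmod (fourier u w))\<^sup>2 * gauss (r *\<^sub>R w))
          \<le> C\<^sup>2 * ((cmod (fourier u w))\<^sup>2 * gauss (r *\<^sub>R w))"
        by (intro mult_right_mono) (auto simp: gauss_nonneg)
      then show ?case
        by (simp add: fourier_conv[OF u k] norm_mult power_mult_distrib mult_ac)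
    qed
  qed (intro integrable_mult_right integrable_gauss_energy h u r)+
  note energy_le = this
  \<comment> \<open>The two sides are treated differently: u enters through an upper bound valid at
    every scale, and the limit is taken for the convolution alone, which is continuous and
    bounded.\<close>
  have le: "ennreal (gauss_energy (1 / real (Suc n)) ?h)
      \<le> ennreal (C\<^sup>2) * (\<integral>\<^sup>+x. (cmod (u x))\<^sup>2 \<partial>lborel)" for n
  proof -
    have "ennreal (gauss_energy (1 / real (Suc n)) ?h) \<le> ennreal (C\<^sup>2 * gauss_energy (1 / real (Suc n)) u)"
      using energy_le[of "1 / real (Suc n)"] by (intro ennreal_leI) simp
    also have "\<dots> = ennreal (C\<^sup>2) * ennreal (gauss_energy (1 / real (Suc n)) u)"
      by (rule ennreal_mult') simp
    also have "\<dots> \<le> ennreal (C\<^sup>2) * (\<integral>\<^sup>+x. (cmod (u x))\<^sup>2 \<partial>lborel)"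
      by (intro mult_left_mono gauss_energy_le[OF u]) auto
    finally show ?thesis .
  qed
  have "(\<lambda>n. ennreal (gauss_energy (1 / real (Suc n)) ?h)) \<longlonglongrightarrow> ennreal (LINT x|lborel. (cmod (?h x))\<^sup>2)"
    by (intro tendsto_ennrealI tendsto_gauss_energy[OF h continuous_conv[OF _ bd k] hM]) simp
  then have "ennreal (LINT x|lborel. (cmod (?h x))\<^sup>2) \<le> ennreal (C\<^sup>2) * (\<integral>\<^sup>+x. (cmod (u x))\<^sup>2 \<partial>lborel)"
    by (rule LIMSEQ_le_const2) (use le in auto)
  then show ?thesis
    by (simp add: nn_integral_eq_integral[OF ih])
qed

lemma integrable_mult_L2:
  fixes f g :: "'b \<Rightarrow> complex"
  assumes [measurable]: "f \<in> borel_measurable M" "g \<in> borel_measurable M"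
    and "integrable M (\<lambda>x. (cmod (f x))\<^sup>2)" "integrable M (\<lambda>x. (cmod (g x))\<^sup>2)"
  shows "integrable M (\<lambda>x. f x * g x)"
proof (rule Bochner_Integration.integrable_bound)
  show "integrable M (\<lambda>x. (cmod (f x))\<^sup>2 + (cmod (g x))\<^sup>2)"
    using assms by simp
  show "AE x in M. norm (f x * g x) \<le> norm ((cmod (f x))\<^sup>2 + (cmod (g x))\<^sup>2)"
  proof (rule AE_I2)
    fix x
    have "2 * (cmod (f x) * cmod (g x)) \<le> (cmod (f x))\<^sup>2 + (cmod (g x))\<^sup>2"
      using sum_squares_bound[of "cmod (f x)" "cmod (g x)"] by (simp add: mult.assoc)
    moreover have "0 \<le> cmod (f x) * cmod (g x)"
      by simp
    ultimately have "cmod (f x) * cmod (g x) \<le> (cmod (f x))\<^sup>2 + (cmod (g x))\<^sup>2"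
      by linarith
    then show "norm (f x * g x) \<le> norm ((cmod (f x))\<^sup>2 + (cmod (g x))\<^sup>2)"
      by (simp add: norm_mult)
  qed
qed measurable

lemma L2_measurable: "f \<in> L2 \<Longrightarrow> f \<in> borel_measurable borel"
  by (simp add: L2_def)

lemma L2_integrable: "f \<in> L2 \<Longrightarrow> integrable lborel (\<lambda>x. (cmod (f x))\<^sup>2)"
  by (simp add: L2_def)

lemma integrable_conv_kernel:
  assumes "f \<in> L2" "g \<in> L2"
  shows "integrable lborel (\<lambda>x. f x * g (y - x))"
proof -
  have [measurable]: "f \<in> borel_measurable borel" "g \<in> borel_measurable borel"
    using assms by (auto simp: L2_measurable)
  show ?thesis
    using assms L2_integrable[of g] integrable_lborel_reflect[of "\<lambda>x. (cmod (g x))\<^sup>2" y]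
    by (intro integrable_mult_L2) (auto simp: L2_integrable)
qed

text \<open>Cutting u off outside \<open>A n\<close> gives bounded integrable functions of no larger
  energy. Their convolutions with k converge at every point, since \<open>u x * k (y - x)\<close> is
  integrable for u and k in \<open>L2\<close>, and Fatou's lemma carries the bound to the
  limit.\<close>

lemma conv_bound:
  fixes u k :: "'a::euclidean_space \<Rightarrow> complex"
  assumes u: "u \<in> L2" and k: "k \<in> L1 \<inter> L2"
    and C: "AE w in lborel. cmod (fourier k w) \<le> C" "C \<ge> 0"
  shows "(\<integral>\<^sup>+x. (cmod (conv u k x))\<^sup>2 \<partial>lborel) \<le> ennreal (C\<^sup>2) * (\<integral>\<^sup>+x. (cmod (u x))\<^sup>2 \<partial>lborel)"
proof -
  have [measurable]: "u \<in> borel_measurable borel" "k \<in> borel_measurable borel"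
    using u k by (auto simp: L2_measurable)
  define A where "A n = {x. norm x \<le> real n \<and> cmod (u x) \<le> real n}" for n
  define v where "v n x = indicator (A n) x * u x" for n x
  have [measurable]: "A n \<in> sets borel" "v n \<in> borel_measurable borel" for n
    unfolding A_def v_def[abs_def] by measurable
  have v_le: "cmod (v n x) \<le> cmod (u x)" for n x
    by (auto simp: v_def indicator_def)
  have v_bd: "cmod (v n x) \<le> real n" for n x
    by (auto simp: v_def indicator_def A_def)
  have iv: "integrable lborel (v n)" for n
  proof (rule Bochner_Integration.integrable_bound)
    show "integrable lborel (\<lambda>x::'a. real n * indicator (cball 0 (real n)) x)"
      by (intro integrable_mult_right integrable_real_indicator) (auto simp: emeasure_lborel_cball_finite[unfolded infinity_ennreal_def])
    show "AE x in lborel. norm (v n x) \<le> norm (real n * indicator (cball 0 (real n)) x)"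
      by (auto simp: v_def indicator_def A_def)
  qed measurable
  have lim_v: "(\<lambda>n. v n x) \<longlonglongrightarrow> u x" for x
  proof (rule tendsto_eventually)
    have "\<forall>\<^sub>F n in sequentially. max (norm x) (cmod (u x)) \<le> real n"
      using filterlim_real_sequentially unfolding filterlim_at_top by blast
    then show "\<forall>\<^sub>F n in sequentially. v n x = u x"
      by eventually_elim (auto simp: v_def A_def)
  qed
  have lim: "(\<lambda>n. conv (v n) k y) \<longlonglongrightarrow> conv u k y" for y
    unfolding conv_def
  proof (rule integral_dominated_convergence)
    show "integrable lborel (\<lambda>x. cmod (u x * k (y - x)))"
      using integrable_conv_kernel[OF u, of k y] k by auto
    show "AE x in lborel. (\<lambda>n. v n x * k (y - x)) \<longlonglongrightarrow> u x * k (y - x)"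
      by (intro AE_I2 tendsto_mult lim_v tendsto_const)
    show "AE x in lborel. norm (v n x * k (y - x)) \<le> cmod (u x * k (y - x))" for n
      unfolding norm_mult by (intro AE_I2 mult_right_mono v_le) simp
  qed measurable
  have "(\<integral>\<^sup>+x. (cmod (conv u k x))\<^sup>2 \<partial>lborel)
      = (\<integral>\<^sup>+x. liminf (\<lambda>n. ennreal ((cmod (conv (v n) k x))\<^sup>2)) \<partial>lborel)"
  proof (intro nn_integral_cong)
    fix x
    have "(\<lambda>n. ennreal ((cmod (conv (v n) k x))\<^sup>2)) \<longlonglongrightarrow> ennreal ((cmod (conv u k x))\<^sup>2)"
      by (intro tendsto_ennrealI tendsto_intros lim)
    then show "ennreal ((cmod (conv u k x))\<^sup>2) = liminf (\<lambda>n. ennreal ((cmod (conv (v n) k x))\<^sup>2))"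
      by (intro lim_imp_Liminf[symmetric]) simp_all
  qed
  also have "\<dots> \<le> liminf (\<lambda>n. \<integral>\<^sup>+x. (cmod (conv (v n) k x))\<^sup>2 \<partial>lborel)"
    by (intro nn_integral_liminf) measurable
  also have "\<dots> \<le> ennreal (C\<^sup>2) * (\<integral>\<^sup>+x. (cmod (u x))\<^sup>2 \<partial>lborel)"
  proof (rule Liminf_le)
    show "\<forall>\<^sub>F n in sequentially. (\<integral>\<^sup>+x. (cmod (conv (v n) k x))\<^sup>2 \<partial>lborel)
        \<le> ennreal (C\<^sup>2) * (\<integral>\<^sup>+x. (cmod (u x))\<^sup>2 \<partial>lborel)"
    proof (intro always_eventually allI)
      fix n
      have "(\<integral>\<^sup>+x. (cmod (conv (v n) k x))\<^sup>2 \<partial>lborel) \<le> ennreal (C\<^sup>2) * (\<integral>\<^sup>+x. (cmod (v n x))\<^sup>2 \<partial>lborel)"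
        using k by (intro conv_bound_bounded[OF iv v_bd _ C]) (simp add: L1_def)
      also have "\<dots> \<le> ennreal (C\<^sup>2) * (\<integral>\<^sup>+x. (cmod (u x))\<^sup>2 \<partial>lborel)"
        by (intro mult_left_mono nn_integral_mono ennreal_leI power_mono v_le) auto
      finally show "(\<integral>\<^sup>+x. (cmod (conv (v n) k x))\<^sup>2 \<partial>lborel)
        \<le> ennreal (C\<^sup>2) * (\<integral>\<^sup>+x. (cmod (u x))\<^sup>2 \<partial>lborel)" .
    qed
  qed simp
  finally show ?thesis .
qed

section \<open>Square-integrable functions\<close>

lemma cmod_iexp_minus_1_le: "cmod (exp (\<i> * complex_of_real x) - 1) \<le> \<bar>x\<bar>"
  using iexp_approx1[of x 0] by simp

lemma L2_norm_nonneg: "0 \<le> L2_norm f"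
  by (simp add: L2_norm_def)

lemma L2_norm_power2: "(L2_norm f)\<^sup>2 = (LINT x|lborel. (cmod (f x))\<^sup>2)"
  by (simp add: L2_norm_def)

lemma nn_integral_L2:
  assumes "f \<in> L2"
  shows "(\<integral>\<^sup>+x. (cmod (f x))\<^sup>2 \<partial>lborel) = ennreal ((L2_norm f)\<^sup>2)"
  using assms by (simp add: L2_norm_power2 nn_integral_eq_integral L2_integrable)

lemma L2I_bound:
  assumes "f \<in> borel_measurable borel" "(\<integral>\<^sup>+x. (cmod (f x))\<^sup>2 \<partial>lborel) \<le> ennreal c"
  shows "f \<in> L2" and "c \<ge> 0 \<Longrightarrow> (L2_norm f)\<^sup>2 \<le> c"
proof -
  have "(\<integral>\<^sup>+x. (cmod (f x))\<^sup>2 \<partial>lborel) < \<infinity>"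
    using assms(2) by (auto simp: less_top[symmetric] top_unique)
  then show f: "f \<in> L2"
    using assms(1) by (auto simp: L2_def integrable_iff_bounded)
  show "(L2_norm f)\<^sup>2 \<le> c" if "c \<ge> 0"
    using assms(2) that by (simp add: nn_integral_L2[OF f])
qed

lemma L2_zero: "(\<lambda>_. 0) \<in> L2"
  by (simp add: L2_def)

lemma L2_diff:
  assumes "f \<in> L2" "g \<in> L2"
  shows "(\<lambda>x. f x - g x) \<in> L2"
proof -
  have [measurable]: "f \<in> borel_measurable borel" "g \<in> borel_measurable borel"
    using assms by (auto simp: L2_measurable)
  have "integrable lborel (\<lambda>x. (cmod (f x - g x))\<^sup>2)"
  proof (rule Bochner_Integration.integrable_bound)
    show "integrable lborel (\<lambda>x. 2 * (cmod (f x))\<^sup>2 + 2 * (cmod (g x))\<^sup>2)"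
      using assms by (auto simp: L2_integrable)
    show "AE x in lborel. norm ((cmod (f x - g x))\<^sup>2) \<le> norm (2 * (cmod (f x))\<^sup>2 + 2 * (cmod (g x))\<^sup>2)"
    proof (rule AE_I2)
      fix x
      have "(cmod (f x - g x))\<^sup>2 \<le> (cmod (f x) + cmod (g x))\<^sup>2"
        by (intro power_mono norm_triangle_ineq4) simp
      also have "\<dots> \<le> 2 * (cmod (f x))\<^sup>2 + 2 * (cmod (g x))\<^sup>2"
        using sum_squares_bound[of "cmod (f x)" "cmod (g x)"] by (simp add: power2_sum)
      finally show "norm ((cmod (f x - g x))\<^sup>2) \<le> norm (2 * (cmod (f x))\<^sup>2 + 2 * (cmod (g x))\<^sup>2)"
        by simp
    qed
  qed measurable
  then show ?thesis
    by (simp add: L2_def)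
qed

lemma L2_translate: "f \<in> L2 \<Longrightarrow> translate t f \<in> L2"
  using integrable_lborel_translate[of "\<lambda>x. (cmod (f x))\<^sup>2" t]
  by (auto simp: L2_def translate_def)

lemma L1_translate: "f \<in> L1 \<Longrightarrow> translate t f \<in> L1"
  by (simp add: L1_def translate_def integrable_lborel_translate)

lemma L2_norm_diff_eq_0_iff:
  assumes "f \<in> L2" "g \<in> L2"
  shows "L2_norm (\<lambda>x. f x - g x) = 0 \<longleftrightarrow> (AE x in lborel. f x = g x)"
  using L2_integrable[OF L2_diff[OF assms]]
  by (simp add: L2_norm_def integral_nonneg_eq_0_iff_AE)

lemma L2_norm_cong_AE:
  assumes "f \<in> L2" "g \<in> L2" "AE x in lborel. f x = g x"
  shows "L2_norm f = L2_norm g"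
proof -
  have "f \<in> borel_measurable borel" "g \<in> borel_measurable borel"
    using assms by (auto simp: L2_measurable)
  then show ?thesis
    unfolding L2_norm_def using assms(3) by (intro arg_cong[where f=sqrt] integral_cong_AE) auto
qed

text \<open>This is the Lipschitz bound at distance 0. It lets an almost everywhere identity for the
  output of the nonlinearity pass through the pooling operator.\<close>

lemma L2_lipschitz_cong_AE:
  assumes F: "L2_lipschitz C F" and fg: "f \<in> L2" "g \<in> L2" "AE x in lborel. f x = g x"
  shows "AE x in lborel. F f x = F g x"
proof -
  have "L2_norm (\<lambda>x. F f x - F g x) \<le> C * L2_norm (\<lambda>x. f x - g x)"
    using F fg by (simp add: L2_lipschitz_def)
  then have "L2_norm (\<lambda>x. F f x - F g x) = 0"
    using fg L2_norm_diff_eq_0_iff[of f g] L2_norm_nonneg[of "\<lambda>x. F f x - F g x"] by simp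
  then show ?thesis
    using F fg by (simp add: L2_norm_diff_eq_0_iff L2_lipschitz_def)
qed

lemma L2_lipschitz_norm_le:
  assumes F: "L2_lipschitz C F" and F0: "AE x in lborel. F (\<lambda>_. 0) x = 0" and f: "f \<in> L2"
  shows "L2_norm (F f) \<le> C * L2_norm f"
proof -
  have FL: "F f \<in> L2" "F (\<lambda>_. 0) \<in> L2"
    using F f L2_zero by (auto simp: L2_lipschitz_def)
  have "L2_norm (F f) = L2_norm (\<lambda>x. F f x - F (\<lambda>_. 0) x)"
    using F0 by (intro L2_norm_cong_AE L2_diff FL) auto
  also have "\<dots> \<le> C * L2_norm (\<lambda>x. f x - 0)"
    using F f L2_zero unfolding L2_lipschitz_def by blast
  finally show ?thesis
    by simp
qed

text \<open>The squared prefactor is s^d, which cancels the Jacobian of the dilation. Pooling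
  factors therefore do not enter the energy estimates.\<close>

lemma L2_dilate:
  fixes f :: "'a::euclidean_space \<Rightarrow> complex"
  assumes f: "f \<in> L2" and s: "s > 0"
  defines "g \<equiv> \<lambda>x. complex_of_real (s powr (real DIM('a) / 2)) * f (s *\<^sub>R x)"
  shows "g \<in> L2" and "L2_norm g = L2_norm f"
proof -
  have [measurable]: "f \<in> borel_measurable borel"
    using f by (rule L2_measurable)
  have "(s powr (real DIM('a) / 2))\<^sup>2 = s ^ DIM('a)"
    using s by (simp add: powr_realpow flip: powr_add add: power2_eq_square)
  then have g: "(cmod (g x))\<^sup>2 = s ^ DIM('a) * (cmod (f (s *\<^sub>R x)))\<^sup>2" for x
    by (simp add: g_def norm_mult power_mult_distrib)
  have [measurable]: "g \<in> borel_measurable borel"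
    unfolding g_def by measurable
  show "g \<in> L2"
    using integrable_affine[OF L2_integrable[OF f], of s 0] s by (simp add: L2_def g)
  show "L2_norm g = L2_norm f"
    using integral_affine[of s "\<lambda>x. (cmod (f x))\<^sup>2" 0] s by (simp add: L2_norm_def g)
qed

text \<open>A shift of the output can be charged to either factor. Charging it to the kernel brings
  the Fourier decay of the atom into play, whereas nothing is known about the smoothness of
  u.\<close>

lemma conv_diff_translate:
  assumes u: "u \<in> L2" and g: "g \<in> L2"
  shows "translate s (conv u g) y - conv u g y = conv u (\<lambda>x. translate s g x - g x) y"
proof -
  have "translate s (conv u g) y = (LINT x|lborel. u x * translate s g (y - x))"
    by (simp add: translate_def conv_def algebra_simps)
  then show ?thesis
    using Bochner_Integration.integral_diff[OF integrable_conv_kernel[OF u L2_translate[OF g]]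
        integrable_conv_kernel[OF u g], of s y y]
    by (simp add: conv_def right_diff_distrib)
qed

lemma L2_norm_conv_translate_le:
  fixes u g :: "'a::euclidean_space \<Rightarrow> complex"
  assumes u: "u \<in> L2" and g: "g \<in> L1 \<inter> L2" and K: "K \<ge> 0"
    and decay: "AE w in lborel. cmod (fourier g w) * norm w \<le> K"
  shows "(\<lambda>x. translate s (conv u g) x - conv u g x) \<in> L2" (is "?d \<in> L2")
    and "L2_norm (\<lambda>x. translate s (conv u g) x - conv u g x) \<le> 2 * pi * norm s * K * L2_norm u"
proof -
  have [measurable]: "u \<in> borel_measurable borel" "g \<in> borel_measurable borel"
    using u g by (auto simp: L2_measurable)
  define k where "k x = translate s g x - g x" for x
  define C where "C = 2 * pi * norm s * K"
  have C: "C \<ge> 0"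
    using K by (simp add: C_def)
  have k: "k \<in> L1 \<inter> L2"
    using g L2_diff[OF L2_translate[of g s], of g] L1_translate[of g s] by (auto simp: k_def[abs_def] L1_def)
  have d: "translate s (conv u g) x - conv u g x = conv u k x" for x
    using g u conv_diff_translate[of u g s] by (auto simp: k_def[abs_def])
  have "AE w in lborel. cmod (fourier k w) \<le> C"
    using decay
  proof eventually_elim
    case (elim w)
    \<comment> \<open>The constant 2\<pi> comes from the phase -2\<pi>
      \<open>(s \<bullet> w)\<close>: after |exp(ix) - 1| \<le> |x|, Cauchy-Schwarz splits the inner
      product into |s|, which stays in the bound, and |w|, which the decay absorbs.\<close>
    have "fourier k w = (exp (\<i> * complex_of_real (- 2 * pi * (s \<bullet> w))) - 1) * fourier g w"
      using g L1_translate[of g s]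
      unfolding k_def[abs_def] by (subst fourier_diff) (auto simp: L1_def fourier_translate algebra_simps)
    then have "cmod (fourier k w) \<le> \<bar>- 2 * pi * (s \<bullet> w)\<bar> * cmod (fourier g w)"
      by (simp only: norm_mult) (intro mult_right_mono cmod_iexp_minus_1_le, simp)
    also have "\<dots> \<le> (2 * pi * (norm s * norm w)) * cmod (fourier g w)"
      using Cauchy_Schwarz_ineq2[of s w] by (intro mult_right_mono) (auto simp: abs_mult)
    also have "\<dots> = 2 * pi * norm s * (cmod (fourier g w) * norm w)"
      by simp
    also have "\<dots> \<le> C"
      unfolding C_def using elim by (intro mult_left_mono) auto
    finally show ?case .
  qed
  from conv_bound[OF u k this C]
  have *: "(\<integral>\<^sup>+x. (cmod (?d x))\<^sup>2 \<partial>lborel) \<le> ennreal ((C * L2_norm u)\<^sup>2)"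
    unfolding d by (simp add: nn_integral_L2[OF u] power_mult_distrib flip: ennreal_mult)
  have meas: "?d \<in> borel_measurable borel"
    unfolding translate_def by measurable
  show "?d \<in> L2"
    by (rule L2I_bound(1)[OF meas *])
  have "(L2_norm ?d)\<^sup>2 \<le> (C * L2_norm u)\<^sup>2"
    by (rule L2I_bound(2)[OF meas *]) simp
  then show "L2_norm ?d \<le> 2 * pi * norm s * K * L2_norm u"
    using C L2_norm_nonneg[of u] unfolding C_def[symmetric] by (auto intro: power2_le_imp_le)
qed

text \<open>An \<open>infsum\<close> in \<open>ennreal\<close> is the supremum of its finite partial
  sums, so the upper frame bound controls each of them. A singleton sum already shows that the
  convolution has finite energy.\<close>

lemma frame_sum_le:
  assumes frame: "semi_discrete_frame I g A B" and f: "f \<in> L2"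
  shows "l \<in> I \<Longrightarrow> conv f (g l) \<in> L2"
    and "finite F \<Longrightarrow> F \<subseteq> I \<Longrightarrow> (\<Sum>l\<in>F. (L2_norm (conv f (g l)))\<^sup>2) \<le> B * (L2_norm f)\<^sup>2"
proof -
  let ?N = "\<lambda>l. \<integral>\<^sup>+b. ennreal ((cmod (conv f (g l) b))\<^sup>2) \<partial>lborel"
  have B: "B > 0" and g: "\<And>l. l \<in> I \<Longrightarrow> g l \<in> L2"
    and bd: "(\<Sum>\<^sub>\<infinity>l\<in>I. ?N l) \<le> ennreal (B * (L2_norm f)\<^sup>2)"
    using frame f by (auto simp: semi_discrete_frame_def L2_inner_translate_involution)
  have le: "(\<Sum>l\<in>F. ?N l) \<le> ennreal (B * (L2_norm f)\<^sup>2)" if "finite F" "F \<subseteq> I" for F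
  proof -
    have "(\<Sum>l\<in>F. ?N l) \<le> (SUP F\<in>{F. finite F \<and> F \<subseteq> I}. \<Sum>l\<in>F. ?N l)"
      using that by (intro SUP_upper) auto
    also have "\<dots> = (\<Sum>\<^sub>\<infinity>l\<in>I. ?N l)"
      by (subst nonneg_infsum_complete) auto
    finally show ?thesis
      using bd by (rule order_trans)
  qed
  have L2: "conv f (g l) \<in> L2" if "l \<in> I" for l
    using le[of "{l}"] that f g[OF that] by (intro L2I_bound(1)[of _ "B * (L2_norm f)\<^sup>2"] conv_measurable) (auto simp: L2_measurable)
  then show "l \<in> I \<Longrightarrow> conv f (g l) \<in> L2" .
  show "(\<Sum>l\<in>F. (L2_norm (conv f (g l)))\<^sup>2) \<le> B * (L2_norm f)\<^sup>2" if F: "finite F" "F \<subseteq> I"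
  proof -
    have "(\<Sum>l\<in>F. ?N l) = (\<Sum>l\<in>F. ennreal ((L2_norm (conv f (g l)))\<^sup>2))"
      using F by (intro sum.cong nn_integral_L2 L2) auto
    then show ?thesis
      using le[OF F] B by simp
  qed
qed

section \<open>Energy and translation covariance of the network\<close>

lemma path_op_Nil: "path_op \<Omega> S [] f = f"
  by (simp add: path_op_def)

text \<open>Enumeration starts at 1, so an entry appended to q belongs to layer
  \<open>Suc (length q)\<close>.\<close>

lemma path_op_snoc: "path_op \<Omega> S (q @ [l]) f = layer_op \<Omega> S (Suc (length q)) l (path_op \<Omega> S q f)"
  by (simp add: path_op_def enumerate_append_eq)

lemma paths_0: "paths \<Omega> 0 = {[]}"
  by (auto simp: paths_def)

lemma paths_length: "q \<in> paths \<Omega> n \<Longrightarrow> length q = n"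
  by (simp add: paths_def)

lemma paths_Suc: "paths \<Omega> (Suc n) = (\<lambda>(q, l). q @ [l]) ` (paths \<Omega> n \<times> inner_index \<Omega> (Suc n))"
proof (intro set_eqI iffI)
  fix p
  assume p: "p \<in> paths \<Omega> (Suc n)"
  then have "p \<noteq> []"
    by (auto simp: paths_def)
  then obtain q l where "p = q @ [l]"
    by (metis append_butlast_last_id)
  with p have "q \<in> paths \<Omega> n" "l \<in> inner_index \<Omega> (Suc n)" "p = q @ [l]"
    by (auto simp: paths_def nth_append All_less_Suc)
  then show "p \<in> (\<lambda>(q, l). q @ [l]) ` (paths \<Omega> n \<times> inner_index \<Omega> (Suc n))"
    by force
next
  fix p
  assume "p \<in> (\<lambda>(q, l). q @ [l]) ` (paths \<Omega> n \<times> inner_index \<Omega> (Suc n))"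
  then show "p \<in> paths \<Omega> (Suc n)"
    by (auto simp: paths_def nth_append All_less_Suc)
qed

locale feature_network =
  fixes \<Omega> :: "('i, 'a::euclidean_space) module_seq" and S :: "nat \<Rightarrow> real"
  assumes module: "module_sequence \<Omega>"
    and admissible: "admissible \<Omega>"
    and pooling: "n \<ge> 1 \<Longrightarrow> S n \<ge> 1"
begin

context
  fixes n :: nat
  assumes n: "n \<ge> 1"
begin

lemma frame: "\<exists>A. semi_discrete_frame (index \<Omega> n) (atom \<Omega> n) A (frame_bd \<Omega> n)"
  and nonlin_lipschitz: "L2_lipschitz (nonlin_lip \<Omega> n) (nonlin \<Omega> n)"
  and pool_lipschitz: "L2_lipschitz (pool_lip \<Omega> n) (pool \<Omega> n)"
  and nonlin_0: "AE x in lborel. nonlin \<Omega> n (\<lambda>_. 0) x = 0"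
  and pool_0: "AE x in lborel. pool \<Omega> n (\<lambda>_. 0) x = 0"
  and lip_pos: "nonlin_lip \<Omega> n > 0" "pool_lip \<Omega> n > 0"
  using module n by (auto simp: module_sequence_def)

lemma frame_bd_le: "frame_bd \<Omega> n \<le> 1" "(pool_lip \<Omega> n * nonlin_lip \<Omega> n)\<^sup>2 * frame_bd \<Omega> n \<le> 1"
  using admissible n by (auto simp: admissible_def power_mult_distrib mult_ac)

lemma conv_atom_L2:
  assumes "f \<in> L2" "l \<in> index \<Omega> n"
  shows "conv f (atom \<Omega> n l) \<in> L2"
proof -
  obtain A where "semi_discrete_frame (index \<Omega> n) (atom \<Omega> n) A (frame_bd \<Omega> n)"
    using frame ..
  then show ?thesis
    using assms by (rule frame_sum_le(1))
qed

lemma nonlin_L2: "f \<in> L2 \<Longrightarrow> nonlin \<Omega> n f \<in> L2"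
  and pool_L2: "f \<in> L2 \<Longrightarrow> pool \<Omega> n f \<in> L2"
  using nonlin_lipschitz pool_lipschitz by (auto simp: L2_lipschitz_def)

lemma layer_op_L2: "f \<in> L2 \<Longrightarrow> l \<in> index \<Omega> n \<Longrightarrow> layer_op \<Omega> S n l f \<in> L2"
  unfolding layer_op_def
  using pooling[OF n] by (intro L2_dilate pool_L2 nonlin_L2 conv_atom_L2) auto

lemma layer_op_norm_le:
  assumes "f \<in> L2" "l \<in> index \<Omega> n"
  shows "L2_norm (layer_op \<Omega> S n l f)
    \<le> pool_lip \<Omega> n * nonlin_lip \<Omega> n * L2_norm (conv f (atom \<Omega> n l))"
proof -
  let ?c = "conv f (atom \<Omega> n l)"
  have c: "?c \<in> L2"
    by (rule conv_atom_L2[OF assms])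
  have "L2_norm (layer_op \<Omega> S n l f) = L2_norm (pool \<Omega> n (nonlin \<Omega> n ?c))"
    unfolding layer_op_def using pooling[OF n] by (intro L2_dilate pool_L2 nonlin_L2 c) auto
  also have "\<dots> \<le> pool_lip \<Omega> n * L2_norm (nonlin \<Omega> n ?c)"
    by (rule L2_lipschitz_norm_le[OF pool_lipschitz pool_0 nonlin_L2[OF c]])
  also have "\<dots> \<le> pool_lip \<Omega> n * (nonlin_lip \<Omega> n * L2_norm ?c)"
    using lip_pos by (intro mult_left_mono L2_lipschitz_norm_le[OF nonlin_lipschitz nonlin_0 c]) auto
  finally show ?thesis
    by (simp add: mult.assoc)
qed

text \<open>The Lipschitz constants contribute
  \<open>(pool_lip \<Omega> n * nonlin_lip \<Omega> n)\<^sup>2\<close> and the frame contributes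
  \<open>frame_bd \<Omega> n\<close>; admissibility bounds exactly this product by 1.\<close>

lemma layer_op_energy_le:
  assumes f: "f \<in> L2" and F: "finite F" "F \<subseteq> index \<Omega> n"
  shows "(\<Sum>l\<in>F. (L2_norm (layer_op \<Omega> S n l f))\<^sup>2) \<le> (L2_norm f)\<^sup>2"
proof -
  let ?c = "(pool_lip \<Omega> n * nonlin_lip \<Omega> n)\<^sup>2"
  obtain A where A: "semi_discrete_frame (index \<Omega> n) (atom \<Omega> n) A (frame_bd \<Omega> n)"
    using frame ..
  have "(\<Sum>l\<in>F. (L2_norm (layer_op \<Omega> S n l f))\<^sup>2) \<le> (\<Sum>l\<in>F. ?c * (L2_norm (conv f (atom \<Omega> n l)))\<^sup>2)"
    unfolding power_mult_distrib[symmetric]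
    using f F by (intro sum_mono power_mono layer_op_norm_le L2_norm_nonneg) auto
  also have "\<dots> = ?c * (\<Sum>l\<in>F. (L2_norm (conv f (atom \<Omega> n l)))\<^sup>2)"
    by (simp add: sum_distrib_left)
  also have "\<dots> \<le> ?c * (frame_bd \<Omega> n * (L2_norm f)\<^sup>2)"
    by (intro mult_left_mono frame_sum_le(2)[OF A f F]) simp
  also have "\<dots> = (?c * frame_bd \<Omega> n) * (L2_norm f)\<^sup>2"
    by simp
  also have "\<dots> \<le> 1 * (L2_norm f)\<^sup>2"
    by (intro mult_right_mono frame_bd_le) simp
  finally show ?thesis
    by simp
qed

end

lemma path_op_L2: "f \<in> L2 \<Longrightarrow> q \<in> paths \<Omega> n \<Longrightarrow> path_op \<Omega> S q f \<in> L2"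
proof (induction n arbitrary: q)
  case (Suc n)
  then show ?case
    by (auto simp: paths_Suc path_op_snoc inner_index_def paths_length intro!: layer_op_L2)
qed (simp add: paths_0 path_op_Nil)

text \<open>Working with finite sets avoids any question of summability. A finite set of paths sits
  inside the product of its prefixes Q and last entries L, and enlarging the sum to that product is
  harmless as the terms are nonnegative. The sum over L is then one layer, and the induction
  hypothesis handles Q.\<close>

lemma path_op_energy_le:
  assumes "f \<in> L2" "finite F" "F \<subseteq> paths \<Omega> n"
  shows "(\<Sum>q\<in>F. (L2_norm (path_op \<Omega> S q f))\<^sup>2) \<le> (L2_norm f)\<^sup>2"
  using assms(2,3)
proof (induction n arbitrary: F)
  case 0
  then have "F = {} \<or> F = {[]}"
    by (auto simp: paths_0)
  then show ?case
    by (auto simp: path_op_Nil)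
next
  case (Suc n)
  define Q where "Q = butlast ` F"
  define L where "L = last ` F"
  have F: "F \<subseteq> (\<lambda>(q, l). q @ [l]) ` (Q \<times> L)"
  proof
    fix p
    assume p: "p \<in> F"
    then have "p \<noteq> []"
      using Suc.prems(2) by (auto simp: paths_Suc)
    then have "p = (\<lambda>(q, l). q @ [l]) (butlast p, last p)"
      by simp
    then show "p \<in> (\<lambda>(q, l). q @ [l]) ` (Q \<times> L)"
      using p unfolding Q_def L_def by blast
  qed
  have QL: "finite Q" "finite L" "Q \<subseteq> paths \<Omega> n" "L \<subseteq> index \<Omega> (Suc n)"
    using Suc.prems by (auto simp: Q_def L_def paths_Suc inner_index_def)
  have "(\<Sum>p\<in>F. (L2_norm (path_op \<Omega> S p f))\<^sup>2)
      \<le> (\<Sum>p\<in>(\<lambda>(q, l). q @ [l]) ` (Q \<times> L). (L2_norm (path_op \<Omega> S p f))\<^sup>2)"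
    using F QL by (intro sum_mono2) auto
  also have "\<dots> = (\<Sum>q\<in>Q. \<Sum>l\<in>L. (L2_norm (path_op \<Omega> S (q @ [l]) f))\<^sup>2)"
    by (subst sum.reindex) (auto simp: inj_on_def sum.cartesian_product case_prod_unfold)
  also have "\<dots> \<le> (\<Sum>q\<in>Q. (L2_norm (path_op \<Omega> S q f))\<^sup>2)"
    unfolding path_op_snoc
  proof (rule sum_mono)
    fix q
    assume "q \<in> Q"
    then have "q \<in> paths \<Omega> n"
      using QL by auto
    then show "(\<Sum>l\<in>L. (L2_norm (layer_op \<Omega> S (Suc (length q)) l (path_op \<Omega> S q f)))\<^sup>2)
        \<le> (L2_norm (path_op \<Omega> S q f))\<^sup>2"
      using QL assms(1) by (intro layer_op_energy_le path_op_L2) (auto simp: paths_length)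
  qed
  also have "\<dots> \<le> (L2_norm f)\<^sup>2"
    by (rule Suc.IH[OF QL(1,3)])
  finally show ?case .
qed

end

text \<open>For each fixed y the integral ignores the exceptional set in x, so the conclusion holds
  at every point. Every layer starts with a convolution, which thus discards the null sets produced
  before it.\<close>

lemma conv_cong_AE:
  assumes "f \<in> L2" "g \<in> L2" "h \<in> L2" "AE x in lborel. f x = g x"
  shows "conv f h = conv g h"
proof
  fix y
  have [measurable]: "f \<in> borel_measurable borel" "g \<in> borel_measurable borel" "h \<in> borel_measurable borel"
    using assms by (auto simp: L2_measurable)
  show "conv f h y = conv g h y"
    unfolding conv_def using assms(4) by (intro integral_cong_AE) auto
qed

section \<open>Translation covariance and the feature bound\<close>

locale translation_covariant_network = feature_network \<Omega> S
  for \<Omega> :: "('i, 'a::euclidean_space) module_seq" and S :: "nat \<Rightarrow> real" +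
  assumes nonlin_commutes: "n \<ge> 1 \<Longrightarrow> commutes_with_translations (nonlin \<Omega> n)"
    and pool_commutes: "n \<ge> 1 \<Longrightarrow> commutes_with_translations (pool \<Omega> n)"
begin

lemma atom_L2: "n \<ge> 1 \<Longrightarrow> l \<in> index \<Omega> n \<Longrightarrow> atom \<Omega> n l \<in> L1 \<inter> L2"
  using frame[of n] by (auto simp: semi_discrete_frame_def)

lemma layer_op_translate:
  assumes n: "n \<ge> 1" and f: "f \<in> L2" and l: "l \<in> index \<Omega> n"
  shows "AE x in lborel. layer_op \<Omega> S n l (translate t f) x
    = translate ((1 / S n) *\<^sub>R t) (layer_op \<Omega> S n l f) x"
proof -
  let ?c = "conv f (atom \<Omega> n l)" and ?M = "nonlin \<Omega> n" and ?P = "pool \<Omega> n"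
  have c: "?c \<in> L2"
    by (rule conv_atom_L2[OF n f l])
  have S: "S n > 0"
    using pooling[OF n] by simp
  have "AE x in lborel. ?M (translate t ?c) x = translate t (?M ?c) x"
    using nonlin_commutes[OF n] c by (simp add: commutes_with_translations_def)
  \<comment> \<open>The nonlinearity commutes with the translation only almost everywhere, so
    pooling is applied to two representatives of one element; its Lipschitz bound identifies the
    results.\<close>
  then have "AE x in lborel. ?P (?M (translate t ?c)) x = ?P (translate t (?M ?c)) x"
    by (rule L2_lipschitz_cong_AE[OF pool_lipschitz[OF n] nonlin_L2[OF n L2_translate[OF c]]
        L2_translate[OF nonlin_L2[OF n c]]])
  moreover have "AE x in lborel. ?P (translate t (?M ?c)) x = translate t (?P (?M ?c)) x"
    using pool_commutes[OF n] nonlin_L2[OF n c] by (simp add: commutes_with_translations_def)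
  ultimately have "AE x in lborel. ?P (?M (translate t ?c)) x = translate t (?P (?M ?c)) x"
    by eventually_elim simp
  from AE_affine[OF this, of "S n" 0] S
  have "AE x in lborel. ?P (?M (translate t ?c)) (S n *\<^sub>R x) = translate t (?P (?M ?c)) (S n *\<^sub>R x)"
    by simp
  then show ?thesis
    unfolding layer_op_def conv_translate_left
    by eventually_elim (use S in \<open>simp add: translate_def scaleR_diff_right\<close>)
qed

lemma path_op_translate:
  assumes f: "f \<in> L2" and q: "q \<in> paths \<Omega> n"
  shows "AE x in lborel. path_op \<Omega> S q (translate t f) x
    = translate ((1 / (\<Prod>k=1..n. S k)) *\<^sub>R t) (path_op \<Omega> S q f) x"
  using q
proof (induction n arbitrary: q)
  case 0
  then show ?case
    by (simp add: paths_0 path_op_Nil)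
next
  case (Suc n)
  let ?s = "(1 / (\<Prod>k=1..n. S k)) *\<^sub>R t"
  obtain p l where q: "q = p @ [l]" and p: "p \<in> paths \<Omega> n" and l: "l \<in> index \<Omega> (Suc n)"
    using Suc.prems by (auto simp: paths_Suc inner_index_def)
  have pL2: "path_op \<Omega> S p f \<in> L2"
    by (rule path_op_L2[OF f p])
  \<comment> \<open>The induction hypothesis holds almost everywhere, but after the convolution both
    sides feed the same function into the nonlinearity, which yields equality of functions
    here.\<close>
  have "layer_op \<Omega> S (Suc n) l (path_op \<Omega> S p (translate t f))
      = layer_op \<Omega> S (Suc n) l (translate ?s (path_op \<Omega> S p f))"
    unfolding layer_op_def
    using conv_cong_AE[OF path_op_L2[OF L2_translate[OF f] p] L2_translate[OF pL2] _ Suc.IH[OF p], of "atom \<Omega> (Suc n) l"]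
      atom_L2[of "Suc n" l] l by simp
  moreover have "AE x in lborel. layer_op \<Omega> S (Suc n) l (translate ?s (path_op \<Omega> S p f)) x
      = translate ((1 / S (Suc n)) *\<^sub>R ?s) (layer_op \<Omega> S (Suc n) l (path_op \<Omega> S p f)) x"
    by (rule layer_op_translate[OF _ pL2 l]) simp
  moreover have "(1 / S (Suc n)) *\<^sub>R ?s = (1 / (\<Prod>k=1..Suc n. S k)) *\<^sub>R t"
    by (simp add: mult.commute)
  ultimately show ?case
    unfolding q path_op_snoc paths_length[OF p] by (simp only:)
qed

lemma out_atom_L2: "out_atom \<Omega> n \<in> L1 \<inter> L2"
  using atom_L2[of "Suc n"] module by (auto simp: out_atom_def module_sequence_def)

text \<open>The exceptional set left by \<open>path_op_translate\<close> disappears in the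
  convolution with the output atom, so the identity is one of functions.\<close>

lemma features_translate:
  assumes f: "f \<in> L2" and q: "q \<in> paths \<Omega> n"
  shows "features \<Omega> S n (translate t f) q
    = translate ((1 / (\<Prod>k=1..n. S k)) *\<^sub>R t) (features \<Omega> S n f q)"
  unfolding features_def conv_translate_left[symmetric]
  by (rule conv_cong_AE[OF path_op_L2[OF L2_translate[OF f] q] L2_translate[OF path_op_L2[OF f q]] _
        path_op_translate[OF f q]]) (use out_atom_L2 in auto)

lemma features_translation_bound:
  fixes t :: 'a
  assumes K: "K > 0" and decay: "AE w in lborel. cmod (fourier (out_atom \<Omega> n) w) * norm w \<le> K"
    and f: "f \<in> L2"
  defines "D \<equiv> \<lambda>q x. features \<Omega> S n (translate t f) q x - features \<Omega> S n f q x"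
  shows "L2_family (paths \<Omega> n) D"
    and "L2_family_norm (paths \<Omega> n) D \<le> 2 * pi * norm t * K / (\<Prod>k=1..n. S k) * L2_norm f"
proof -
  define s where "s = (1 / (\<Prod>k=1..n. S k)) *\<^sub>R t"
  define C where "C = 2 * pi * norm s * K"
  have P: "(\<Prod>k=1..n. S k) > 0"
    using pooling by (intro prod_pos) (auto intro: less_le_trans[OF zero_less_one])
  then have C_eq: "C = 2 * pi * norm t * K / (\<Prod>k=1..n. S k)"
    by (simp add: C_def s_def)
  have C: "C \<ge> 0"
    using K by (simp add: C_def)
  have D: "D q \<in> L2" "(L2_norm (D q))\<^sup>2 \<le> C\<^sup>2 * (L2_norm (path_op \<Omega> S q f))\<^sup>2" if q: "q \<in> paths \<Omega> n" for q
  proof -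
    let ?u = "path_op \<Omega> S q f"
    have "D q = (\<lambda>x. translate s (conv ?u (out_atom \<Omega> n)) x - conv ?u (out_atom \<Omega> n) x)"
      unfolding D_def features_translate[OF f q] s_def by (simp add: features_def)
    then have "D q \<in> L2" "L2_norm (D q) \<le> C * L2_norm ?u"
      using L2_norm_conv_translate_le[OF path_op_L2[OF f q] out_atom_L2 less_imp_le[OF K] decay, of s]
      by (auto simp: C_def)
    then show "D q \<in> L2" "(L2_norm (D q))\<^sup>2 \<le> C\<^sup>2 * (L2_norm ?u)\<^sup>2"
      unfolding power_mult_distrib[symmetric] by (auto intro!: power_mono L2_norm_nonneg)
  qed
  have sum_le: "(\<Sum>q\<in>F. (L2_norm (D q))\<^sup>2) \<le> (C * L2_norm f)\<^sup>2" if F: "finite F" "F \<subseteq> paths \<Omega> n" for F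
  proof -
    have "(\<Sum>q\<in>F. (L2_norm (D q))\<^sup>2) \<le> (\<Sum>q\<in>F. C\<^sup>2 * (L2_norm (path_op \<Omega> S q f))\<^sup>2)"
      using F by (intro sum_mono D) auto
    also have "\<dots> = C\<^sup>2 * (\<Sum>q\<in>F. (L2_norm (path_op \<Omega> S q f))\<^sup>2)"
      by (simp add: sum_distrib_left)
    also have "\<dots> \<le> C\<^sup>2 * (L2_norm f)\<^sup>2"
      by (intro mult_left_mono path_op_energy_le[OF f F]) simp
    finally show ?thesis
      by (simp add: power_mult_distrib)
  qed
  \<comment> \<open>Summability comes from the uniform bound on finite sums. It rules out the
    default value 0 of \<open>infsum\<close>, with which the norm bound would be vacuous.\<close>
  have summable: "(\<lambda>q. (L2_norm (D q))\<^sup>2) summable_on paths \<Omega> n"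
    by (rule nonneg_bdd_above_summable_on) (auto intro!: bdd_aboveI2 sum_le)
  then show "L2_family (paths \<Omega> n) D"
    using D(1) by (simp add: L2_family_def)
  have "(\<Sum>\<^sub>\<infinity>q\<in>paths \<Omega> n. (L2_norm (D q))\<^sup>2) \<le> (C * L2_norm f)\<^sup>2"
    by (rule infsum_le_finite_sums[OF summable sum_le])
  then have "L2_family_norm (paths \<Omega> n) D \<le> C * L2_norm f"
    unfolding L2_family_norm_def using C L2_norm_nonneg[of f] by (intro real_le_lsqrt) auto
  then show "L2_family_norm (paths \<Omega> n) D \<le> 2 * pi * norm t * K / (\<Prod>k=1..n. S k) * L2_norm f"
    by (simp only: C_eq)
qed

end

theorem theorem1:
  fixes \<Omega> :: "('i, 'a::euclidean_space) module_seq"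
    and S :: "nat \<Rightarrow> real"
  assumes "module_sequence \<Omega>"
    and "admissible \<Omega>"
    and "\<forall>n\<ge>1. S n \<ge> 1"
    and "\<forall>n\<ge>1. commutes_with_translations (nonlin \<Omega> n)"
    and "\<forall>n\<ge>1. commutes_with_translations (pool \<Omega> n)"
  shows "(\<forall>f\<in>L2. \<forall>t. \<forall>n\<ge>1. \<forall>q\<in>paths \<Omega> n. AE x in lborel.
           features \<Omega> S n (translate t f) q x
             = translate ((1 / (\<Prod>k=1..n. S k)) *\<^sub>R t) (features \<Omega> S n f q) x) \<and>
         (\<forall>K>0. (\<forall>n. AE w in lborel. cmod (fourier (out_atom \<Omega> n) w) * norm w \<le> K) \<longrightarrow>
           (\<forall>f\<in>L2. \<forall>t. \<forall>n\<ge>1.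
              L2_family (paths \<Omega> n)
                (\<lambda>q x. features \<Omega> S n (translate t f) q x - features \<Omega> S n f q x) \<and>
              L2_family_norm (paths \<Omega> n)
                (\<lambda>q x. features \<Omega> S n (translate t f) q x - features \<Omega> S n f q x)
                \<le> 2 * pi * norm t * K / (\<Prod>k=1..n. S k) * L2_norm f))"
proof -
  interpret translation_covariant_network \<Omega> S
    using assms by unfold_locales auto
  show ?thesis
    using features_translate features_translation_bound by auto
qed

end
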